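(* Let $k$ be a field, $V$ a finite-dimensional $k$-vector space and $b:V\times V\to k$ an anisotropic symmetric $k$-bilinear form. Then the map $$\Omega:\mathrm{PPU}(b)^-\to\mathrm{Sub}(V^{\oplus}),\qquad \varphi\mapsto\ker\big(V^{\oplus}\to V^{\oplus},\ v\mapsto\varphi v\big)$$ is an isomorphism of posets, where $\mathrm{PPU}(b)^-$ is ordered by right-divisibility and $\mathrm{Sub}(V^\oplus)$ by inclusion. In particular, $\mathrm{PPU}(b)^-$ is a modular lattice with respect to right-divisibility.
   Context: Anisotropic means $b(v,v)=0\Leftrightarrow v=0$. Let $V[t,t^{-1}]:=k[t,t^{-1}]\otimes_k V$; its elements are finite sums $v=\sum_{i\in\mathbb Z}t^iv_i$ with $v_i\in V$. Define $\tilde b(v,w)=\sum_{n\in\mathbb Z} t^n\big(\sum_{i\in\mathbb Z} b(v_{i-n},w_i)\big)\in k[t,t^{-1}]$. Each $\varphi\in \mathrm{End}_{k[t,t^{-1}]}V[t,t^{-1}]$ is uniquely a finite sum $\varphi=\sum_i t^i\varphi_i$ with $\varphi_i\in\mathrm{End}_kV$; put $\varphi(1)=\sum_i\varphi_i$. The paraunitary group $\mathrm{PU}(b)$ is the group of all $k[t,t^{-1}]$-linear automorphisms $\varphi$ of $V[t,t^{-1}]$ with $\tilde b(\varphi(v),\varphi(w))=\tilde b(v,w)$ for all $v,w$. The pure paraunitary group is $\mathrm{PPU}(b)=\{\varphi\in \mathrm{PU}(b):\varphi(1)=\mathrm{id}_V\}$, and $\mathrm{PPU}(b)^-$ is the submonoid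 of those $\varphi\in\mathrm{PPU}(b)$ with $\varphi_i=0$ for all $i>0$. $V[t^{-1}]:=k[t^{-1}]\otimes_kV\subseteq V[t,t^{-1}]$, and $V^{\oplus}:=V[t,t^{-1}]/V[t^{-1}]$ as a $k[t^{-1}]$-module. Elements of $\mathrm{PPU}(b)^-$ map $V[t^{-1}]$ into itself and hence act $k[t^{-1}]$-linearly on $V^\oplus$. $\mathrm{Sub}(V^\oplus)$ is the lattice of finitely generated $k[t^{-1}]$-submodules of $V^\oplus$, ordered by inclusion. Right-divisibility order on $\mathrm{PPU}(b)^-$: $\varphi$ is below $\psi$ iff $\psi=\chi\varphi$ for some $\chi\in\mathrm{PPU}(b)^-$. *)

theory Defs
  imports
    "HOL-Algebra.Lattice"
    "HOL-Library.Poly_Mapping"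
    "HOL-Computational_Algebra.Polynomial"
begin

section \<open>Symmetric bilinear forms\<close>

definition bilinear_form :: "('k::field \<Rightarrow> 'v::ab_group_add \<Rightarrow> 'v) \<Rightarrow> ('v \<Rightarrow> 'v \<Rightarrow> 'k) \<Rightarrow> bool"
  where "bilinear_form scale b \<longleftrightarrow>
    (\<forall>v. Vector_Spaces.linear scale (*) (\<lambda>w. b v w)) \<and>
    (\<forall>w. Vector_Spaces.linear scale (*) (\<lambda>v. b v w))"

definition symmetric_form :: "('v \<Rightarrow> 'v \<Rightarrow> 'k) \<Rightarrow> bool"
  where "symmetric_form b \<longleftrightarrow> (\<forall>v w. b v w = b w v)"

definition anisotropic :: "('v::zero \<Rightarrow> 'v \<Rightarrow> 'k::zero) \<Rightarrow> bool"
  where "anisotropic b \<longleftrightarrow> (\<forall>v. b v v = 0 \<longleftrightarrow> v = 0)"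


section \<open>Laurent polynomials and Laurent vectors\<close>

text \<open>
  The ring \<open>k[t,t\<^sup>-\<^sup>1]\<close> is the type \<^typ>\<open>int \<Rightarrow>\<^sub>0 'k\<close> with its convolution product, and
  \<open>V[t,t\<^sup>-\<^sup>1]\<close> is the type \<^typ>\<open>int \<Rightarrow>\<^sub>0 'v\<close>; in both, \<^term>\<open>Poly_Mapping.single i x\<close> is \<open>t\<^sup>i x\<close>.
  \<^const>\<open>Sum_any\<close> is the sum over a whole type of a finitely supported function.
\<close>

definition laurent_scale ::
    "('k::zero \<Rightarrow> 'v::comm_monoid_add \<Rightarrow> 'v) \<Rightarrow> (int \<Rightarrow>\<^sub>0 'k) \<Rightarrow> (int \<Rightarrow>\<^sub>0 'v) \<Rightarrow> (int \<Rightarrow>\<^sub>0 'v)"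
  where "laurent_scale scale p v =
    Sum_any (\<lambda>i. Sum_any (\<lambda>j.
      Poly_Mapping.single (i + j) (scale (Poly_Mapping.lookup p i) (Poly_Mapping.lookup v j))))"

definition laurent_form ::
    "('v::zero \<Rightarrow> 'v \<Rightarrow> 'k::comm_monoid_add) \<Rightarrow> (int \<Rightarrow>\<^sub>0 'v) \<Rightarrow> (int \<Rightarrow>\<^sub>0 'v) \<Rightarrow> (int \<Rightarrow>\<^sub>0 'k)"
  where "laurent_form b v w =
    Sum_any (\<lambda>n. Poly_Mapping.single n
      (Sum_any (\<lambda>i. b (Poly_Mapping.lookup v (i - n)) (Poly_Mapping.lookup w i))))"

text \<open>
  For a \<open>k[t,t\<^sup>-\<^sup>1]\<close>-linear \<open>\<phi>\<close>, the coefficient \<open>\<phi>\<^sub>i\<close> in \<open>\<phi> = \<Sum>\<^sub>i t\<^sup>i \<phi>\<^sub>i\<close> sends \<open>x \<in> V\<close> to the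
  coefficient of \<open>t\<^sup>i\<close> in \<open>\<phi>(1 \<otimes> x)\<close>; the lemma \<open>lookup_laurent_endo\<close> below confirms the expansion.
\<close>

definition endo_coeff :: "((int \<Rightarrow>\<^sub>0 'v::zero) \<Rightarrow> (int \<Rightarrow>\<^sub>0 'v)) \<Rightarrow> int \<Rightarrow> 'v \<Rightarrow> 'v"
  where "endo_coeff \<phi> i x = Poly_Mapping.lookup (\<phi> (Poly_Mapping.single 0 x)) i"

definition endo_at_one :: "((int \<Rightarrow>\<^sub>0 'v::comm_monoid_add) \<Rightarrow> (int \<Rightarrow>\<^sub>0 'v)) \<Rightarrow> 'v \<Rightarrow> 'v"
  where "endo_at_one \<phi> x = Sum_any (\<lambda>i. endo_coeff \<phi> i x)"


section \<open>Paraunitary groups\<close>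

definition PU ::
    "('k::field \<Rightarrow> 'v::ab_group_add \<Rightarrow> 'v) \<Rightarrow> ('v \<Rightarrow> 'v \<Rightarrow> 'k) \<Rightarrow> ((int \<Rightarrow>\<^sub>0 'v) \<Rightarrow> (int \<Rightarrow>\<^sub>0 'v)) set"
  where "PU scale b =
    {\<phi>. module_hom (laurent_scale scale) (laurent_scale scale) \<phi> \<and> bij \<phi> \<and>
        (\<forall>v w. laurent_form b (\<phi> v) (\<phi> w) = laurent_form b v w)}"

definition PPU ::
    "('k::field \<Rightarrow> 'v::ab_group_add \<Rightarrow> 'v) \<Rightarrow> ('v \<Rightarrow> 'v \<Rightarrow> 'k) \<Rightarrow> ((int \<Rightarrow>\<^sub>0 'v) \<Rightarrow> (int \<Rightarrow>\<^sub>0 'v)) set"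
  where "PPU scale b = {\<phi> \<in> PU scale b. endo_at_one \<phi> = id}"

definition PPU_minus ::
    "('k::field \<Rightarrow> 'v::ab_group_add \<Rightarrow> 'v) \<Rightarrow> ('v \<Rightarrow> 'v \<Rightarrow> 'k) \<Rightarrow> ((int \<Rightarrow>\<^sub>0 'v) \<Rightarrow> (int \<Rightarrow>\<^sub>0 'v)) set"
  where "PPU_minus scale b = {\<phi> \<in> PPU scale b. \<forall>i>0. endo_coeff \<phi> i = (\<lambda>_. 0)}"

definition right_divides ::
    "('k::field \<Rightarrow> 'v::ab_group_add \<Rightarrow> 'v) \<Rightarrow> ('v \<Rightarrow> 'v \<Rightarrow> 'k) \<Rightarrow>
     ((int \<Rightarrow>\<^sub>0 'v) \<Rightarrow> (int \<Rightarrow>\<^sub>0 'v)) \<Rightarrow> ((int \<Rightarrow>\<^sub>0 'v) \<Rightarrow> (int \<Rightarrow>\<^sub>0 'v)) \<Rightarrow> bool"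
  where "right_divides scale b \<phi> \<psi> \<longleftrightarrow> (\<exists>\<chi> \<in> PPU_minus scale b. \<psi> = \<chi> \<circ> \<phi>)"

definition PPU_minus_order ::
    "('k::field \<Rightarrow> 'v::ab_group_add \<Rightarrow> 'v) \<Rightarrow> ('v \<Rightarrow> 'v \<Rightarrow> 'k) \<Rightarrow> ((int \<Rightarrow>\<^sub>0 'v) \<Rightarrow> (int \<Rightarrow>\<^sub>0 'v)) gorder"
  where "PPU_minus_order scale b =
    \<lparr>carrier = PPU_minus scale b, eq = (=), le = right_divides scale b\<rparr>"


section \<open>The quotient \<open>V[t,t\<^sup>-\<^sup>1] / V[t\<^sup>-\<^sup>1]\<close>\<close>

definition laurent_neg :: "(int \<Rightarrow>\<^sub>0 'v::zero) set"
  where "laurent_neg = {v. \<forall>i>0. Poly_Mapping.lookup v i = 0}"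

lemma laurent_neg_zero: "0 \<in> laurent_neg"
  by (simp add: laurent_neg_def)

lemma laurent_neg_add: "v \<in> laurent_neg \<Longrightarrow> w \<in> laurent_neg \<Longrightarrow> v + w \<in> laurent_neg"
  for v w :: "int \<Rightarrow>\<^sub>0 'v::ab_group_add"
  by (simp add: laurent_neg_def lookup_add)

lemma laurent_neg_uminus: "v \<in> laurent_neg \<Longrightarrow> - v \<in> laurent_neg"
  for v :: "int \<Rightarrow>\<^sub>0 'v::ab_group_add"
  by (simp add: laurent_neg_def)

quotient_type (overloaded) 'v voplus = "int \<Rightarrow>\<^sub>0 ('v::ab_group_add)" / "\<lambda>v w. v - w \<in> laurent_neg"
proof (rule equivpI)
  show "reflp (\<lambda>v w. v - w \<in> (laurent_neg :: (int \<Rightarrow>\<^sub>0 'v) set))"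
    by (simp add: reflp_def laurent_neg_zero)
  show "symp (\<lambda>v w. v - w \<in> (laurent_neg :: (int \<Rightarrow>\<^sub>0 'v) set))"
    by (rule sympI) (drule laurent_neg_uminus, simp)
  show "transp (\<lambda>v w. v - w \<in> (laurent_neg :: (int \<Rightarrow>\<^sub>0 'v) set))"
    by (rule transpI) (drule (1) laurent_neg_add, simp)
qed

instantiation voplus :: (ab_group_add) ab_group_add
begin

lift_definition zero_voplus :: "'a voplus" is 0 .

lift_definition plus_voplus :: "'a voplus \<Rightarrow> 'a voplus \<Rightarrow> 'a voplus" is "(+)"
  by (drule (1) laurent_neg_add) (simp add: algebra_simps)

lift_definition uminus_voplus :: "'a voplus \<Rightarrow> 'a voplus" is uminus
  by (drule laurent_neg_uminus) simp

lift_definition minus_voplus :: "'a voplus \<Rightarrow> 'a voplus \<Rightarrow> 'a voplus" is "(-)"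
  by (drule (1) laurent_neg_add[OF _ laurent_neg_uminus]) (simp add: algebra_simps)

instance
  by standard (transfer, simp add: algebra_simps laurent_neg_zero)+

end

text \<open>
  The ring \<open>k[t\<^sup>-\<^sup>1]\<close> is \<^typ>\<open>'k poly\<close>, with the indeterminate standing for \<open>t\<^sup>-\<^sup>1\<close>; the following is
  its inclusion into \<open>k[t,t\<^sup>-\<^sup>1]\<close>.
\<close>

definition poly_to_laurent :: "'k::comm_ring_1 poly \<Rightarrow> (int \<Rightarrow>\<^sub>0 'k)"
  where "poly_to_laurent p = poly (map_poly (Poly_Mapping.single 0) p) (Poly_Mapping.single (- 1) 1)"

definition voplus_scale ::
    "('k::comm_ring_1 \<Rightarrow> 'v::ab_group_add \<Rightarrow> 'v) \<Rightarrow> 'k poly \<Rightarrow> 'v voplus \<Rightarrow> 'v voplus"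
  where "voplus_scale scale p =
    map_fun rep_voplus abs_voplus (laurent_scale scale (poly_to_laurent p))"

definition voplus_map ::
    "((int \<Rightarrow>\<^sub>0 'v::ab_group_add) \<Rightarrow> (int \<Rightarrow>\<^sub>0 'v)) \<Rightarrow> 'v voplus \<Rightarrow> 'v voplus"
  where "voplus_map \<phi> = map_fun rep_voplus abs_voplus \<phi>"

definition Sub_voplus :: "('k::field \<Rightarrow> 'v::ab_group_add \<Rightarrow> 'v) \<Rightarrow> 'v voplus set set"
  where "Sub_voplus scale =
    {M. module.subspace (voplus_scale scale) M \<and>
        (\<exists>S. finite S \<and> module.span (voplus_scale scale) S = M)}"

definition Sub_voplus_order :: "('k::field \<Rightarrow> 'v::ab_group_add \<Rightarrow> 'v) \<Rightarrow> 'v voplus set gorder"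
  where "Sub_voplus_order scale = \<lparr>carrier = Sub_voplus scale, eq = (=), le = (\<subseteq>)\<rparr>"

definition Omega :: "((int \<Rightarrow>\<^sub>0 'v::ab_group_add) \<Rightarrow> (int \<Rightarrow>\<^sub>0 'v)) \<Rightarrow> 'v voplus set"
  where "Omega \<phi> = {x. voplus_map \<phi> x = 0}"


section \<open>Posets\<close>

definition poset_isomorphism :: "'a gorder \<Rightarrow> 'b gorder \<Rightarrow> ('a \<Rightarrow> 'b) \<Rightarrow> bool"
  where "poset_isomorphism L M f \<longleftrightarrow>
    partial_order L \<and> partial_order M \<and> bij_betw f (carrier L) (carrier M) \<and>
    (\<forall>x \<in> carrier L. \<forall>y \<in> carrier L. x \<sqsubseteq>\<^bsub>L\<^esub> y \<longleftrightarrow> f x \<sqsubseteq>\<^bsub>M\<^esub> f y)"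

locale modular_lattice = lattice +
  assumes modular_law: "\<lbrakk>x \<in> carrier L; y \<in> carrier L; z \<in> carrier L; x \<sqsubseteq> z\<rbrakk> \<Longrightarrow>
    x \<squnion> (y \<sqinter> z) = (x \<squnion> y) \<sqinter> z"


section \<open>Well-definedness\<close>

lemma poly_mapping_update_add:
  "k \<notin> Poly_Mapping.keys f \<Longrightarrow> Poly_Mapping.update k a f = f + Poly_Mapping.single k a"
  for f :: "'i \<Rightarrow>\<^sub>0 'm::comm_monoid_add"
  by (rule poly_mapping_eqI)
    (auto simp: lookup_update lookup_add lookup_single in_keys_iff when_def)

context vector_space
begin

lemma laurent_scale_superset:
  assumes "finite A" "finite B" "Poly_Mapping.keys p \<subseteq> A" "Poly_Mapping.keys v \<subseteq> B"
  shows "laurent_scale scale p v = (\<Sum>i\<in>A. \<Sum>j\<in>B.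
    Poly_Mapping.single (i + j) (scale (Poly_Mapping.lookup p i) (Poly_Mapping.lookup v j)))"
proof -
  have inner: "Sum_any (\<lambda>j. Poly_Mapping.single (i + j) (scale c (Poly_Mapping.lookup v j)))
      = (\<Sum>j\<in>B. Poly_Mapping.single (i + j) (scale c (Poly_Mapping.lookup v j)))" for i c
  proof (rule Sum_any.expand_superset[OF assms(2)])
    show "{j. Poly_Mapping.single (i + j) (scale c (Poly_Mapping.lookup v j)) \<noteq> 0} \<subseteq> B"
      by clarify (metis assms(4) in_keys_iff scale_zero_right single_zero subsetD)
  qed
  show ?thesis
    unfolding laurent_scale_def inner
  proof (rule Sum_any.expand_superset[OF assms(1)])
    show "{i. (\<Sum>j\<in>B. Poly_Mapping.single (i + j)
        (scale (Poly_Mapping.lookup p i) (Poly_Mapping.lookup v j))) \<noteq> 0} \<subseteq> A"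
    proof clarify
      fix i
      assume "(\<Sum>j\<in>B. Poly_Mapping.single (i + j)
        (scale (Poly_Mapping.lookup p i) (Poly_Mapping.lookup v j))) \<noteq> 0"
      then have "Poly_Mapping.lookup p i \<noteq> 0" by (cases "Poly_Mapping.lookup p i = 0") simp_all
      then show "i \<in> A" using assms(3) by (auto simp: in_keys_iff)
    qed
  qed
qed

lemma lookup_laurent_scale:
  assumes "finite A" "Poly_Mapping.keys p \<subseteq> A"
  shows "Poly_Mapping.lookup (laurent_scale scale p v) n =
    (\<Sum>i\<in>A. scale (Poly_Mapping.lookup p i) (Poly_Mapping.lookup v (n - i)))"
proof -
  have "Poly_Mapping.lookup (laurent_scale scale p v) n =
    (\<Sum>i\<in>A. \<Sum>j\<in>Poly_Mapping.keys v. 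
      (scale (Poly_Mapping.lookup p i) (Poly_Mapping.lookup v j) when i + j = n))"
    by (subst laurent_scale_superset[OF assms(1) finite_keys assms(2) subset_refl])
      (simp add: lookup_sum lookup_single)
  also have "\<dots> = (\<Sum>i\<in>A. scale (Poly_Mapping.lookup p i) (Poly_Mapping.lookup v (n - i)))"
  proof (rule sum.cong[OF refl])
    fix i
    have "(\<Sum>j\<in>Poly_Mapping.keys v. 
        (scale (Poly_Mapping.lookup p i) (Poly_Mapping.lookup v j) when i + j = n)) =
      (\<Sum>j\<in>Poly_Mapping.keys v.
        (if n - i = j then scale (Poly_Mapping.lookup p i) (Poly_Mapping.lookup v j) else 0))"
      by (rule sum.cong) (auto simp: when_def)
    also have "\<dots> = scale (Poly_Mapping.lookup p i) (Poly_Mapping.lookup v (n - i))"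
      by (subst sum.delta') (auto simp: in_keys_iff)
    finally show "(\<Sum>j\<in>Poly_Mapping.keys v. 
        (scale (Poly_Mapping.lookup p i) (Poly_Mapping.lookup v j) when i + j = n)) =
      scale (Poly_Mapping.lookup p i) (Poly_Mapping.lookup v (n - i))" .
  qed
  finally show ?thesis .
qed

lemma lookup_laurent_scale_single:
  "Poly_Mapping.lookup (laurent_scale scale (Poly_Mapping.single i a) v) n =
    scale a (Poly_Mapping.lookup v (n - i))"
  by (subst lookup_laurent_scale[of "{i}"]) auto

lemma laurent_scale_add_left:
  "laurent_scale scale (p + q) v = laurent_scale scale p v + laurent_scale scale q v"
proof (rule poly_mapping_eqI)
  fix n
  let ?A = "Poly_Mapping.keys p \<union> Poly_Mapping.keys q"
  have fin: "finite ?A" and sub: "Poly_Mapping.keys (p + q) \<subseteq> ?A"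
    by (auto dest: subsetD[OF Poly_Mapping.keys_add])
  show "Poly_Mapping.lookup (laurent_scale scale (p + q) v) n =
    Poly_Mapping.lookup (laurent_scale scale p v + laurent_scale scale q v) n"
    by (simp add: lookup_add lookup_laurent_scale[OF fin sub] lookup_laurent_scale[OF fin Un_upper1]
      lookup_laurent_scale[OF fin Un_upper2] scale_left_distrib sum.distrib)
qed

lemma laurent_scale_add_right:
  "laurent_scale scale p (v + w) = laurent_scale scale p v + laurent_scale scale p w"
  by (rule poly_mapping_eqI)
    (simp add: lookup_add lookup_laurent_scale[OF finite_keys subset_refl]
      scale_right_distrib sum.distrib)

lemma laurent_scale_zero_left: "laurent_scale scale 0 v = 0"
  by (rule poly_mapping_eqI) (simp add: lookup_laurent_scale[of "{}"])

lemma laurent_scale_zero_right: "laurent_scale scale p 0 = 0"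
  by (rule poly_mapping_eqI) (simp add: lookup_laurent_scale[OF finite_keys subset_refl])

lemma laurent_scale_assoc:
  "laurent_scale scale p (laurent_scale scale q v) = laurent_scale scale (p * q) v"
proof (induction p rule: update_induct)
  case const
  show ?case by (simp add: laurent_scale_zero_left)
next
  case (update p i a)
  have single: "laurent_scale scale (Poly_Mapping.single i a) (laurent_scale scale q v) =
    laurent_scale scale (Poly_Mapping.single i a * q) v"
  proof (induction q rule: update_induct)
    case const
    show ?case by (simp add: laurent_scale_zero_left laurent_scale_zero_right)
  next
    case (update q j c)
    have "laurent_scale scale (Poly_Mapping.single i a)
        (laurent_scale scale (Poly_Mapping.single j c) v) =
      laurent_scale scale (Poly_Mapping.single i a * Poly_Mapping.single j c) v"
      by (rule poly_mapping_eqI) (simp add: lookup_laurent_scale_single mult_single algebra_simps)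
    with update show ?case
      by (simp add: poly_mapping_update_add laurent_scale_add_left laurent_scale_add_right
          distrib_left)
  qed
  with update show ?case
    by (simp add: poly_mapping_update_add laurent_scale_add_left distrib_right)
qed

lemma module_laurent_scale: "module (laurent_scale scale)"
proof
  fix v :: "int \<Rightarrow>\<^sub>0 'b"
  have "laurent_scale scale (Poly_Mapping.single 0 1) v = v"
    by (rule poly_mapping_eqI) (simp add: lookup_laurent_scale_single del: single_one)
  then show "laurent_scale scale 1 v = v" by (simp only: single_one)
qed (simp_all add: laurent_scale_add_left laurent_scale_add_right laurent_scale_assoc)

lemma lookup_laurent_form:
  assumes "bilinear_form scale b"
  shows "Poly_Mapping.lookup (laurent_form b v w) n =
    (\<Sum>i\<in>Poly_Mapping.keys w. b (Poly_Mapping.lookup v (i - n)) (Poly_Mapping.lookup w i))"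
proof -
  interpret r: Vector_Spaces.linear scale "(*)" "\<lambda>y. b x y" for x
    using assms by (simp add: bilinear_form_def)
  interpret l: Vector_Spaces.linear scale "(*)" "\<lambda>x. b x y" for y
    using assms by (simp add: bilinear_form_def)
  have inner: "Sum_any (\<lambda>i. b (Poly_Mapping.lookup v (i - n)) (Poly_Mapping.lookup w i)) =
    (\<Sum>i\<in>Poly_Mapping.keys w. b (Poly_Mapping.lookup v (i - n)) (Poly_Mapping.lookup w i))" for n
    by (rule Sum_any.expand_superset[OF finite_keys], clarify) (metis in_keys_iff r.zero)
  let ?f = "\<lambda>n. \<Sum>i\<in>Poly_Mapping.keys w. b (Poly_Mapping.lookup v (i - n)) (Poly_Mapping.lookup w i)"
  let ?N = "(\<lambda>(i, j). i - j) ` (Poly_Mapping.keys w \<times> Poly_Mapping.keys v)"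
  have zero: "?f n = 0" if "n \<notin> ?N" for n
  proof (rule sum.neutral, rule ballI)
    fix i assume "i \<in> Poly_Mapping.keys w"
    then have "i - n \<notin> Poly_Mapping.keys v"
      using that by (force simp: image_iff)
    then show "b (Poly_Mapping.lookup v (i - n)) (Poly_Mapping.lookup w i) = 0"
      by (simp add: in_keys_iff)
  qed
  have "laurent_form b v w = (\<Sum>n\<in>?N. Poly_Mapping.single n (?f n))"
    unfolding laurent_form_def inner
  proof (rule Sum_any.expand_superset)
    show "{n. Poly_Mapping.single n (?f n) \<noteq> 0} \<subseteq> ?N"
      using zero by (metis (mono_tags, lifting) mem_Collect_eq single_zero subsetI)
  qed simp
  then have "Poly_Mapping.lookup (laurent_form b v w) n = (\<Sum>m\<in>?N. if m = n then ?f m else 0)"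
    by (simp only: lookup_sum lookup_single when_def)
  also have "\<dots> = ?f n"
    by (subst sum.delta) (auto simp: zero)
  finally show ?thesis .
qed

lemma lookup_laurent_endo:
  assumes "module_hom (laurent_scale scale) (laurent_scale scale) \<phi>"
  shows "Poly_Mapping.lookup (\<phi> v) n =
    (\<Sum>j\<in>Poly_Mapping.keys v. endo_coeff \<phi> (n - j) (Poly_Mapping.lookup v j))"
proof -
  interpret module_hom "laurent_scale scale" "laurent_scale scale" \<phi> by fact
  have decomp: "Poly_Mapping.single j x =
    laurent_scale scale (Poly_Mapping.single j 1) (Poly_Mapping.single 0 x)" for j x
    by (rule poly_mapping_eqI) (simp add: lookup_laurent_scale_single lookup_single when_def)
  have "v = (\<Sum>j\<in>Poly_Mapping.keys v. Poly_Mapping.single j (Poly_Mapping.lookup v j))"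
    by (rule poly_mapping_eqI)
      (auto simp: lookup_sum lookup_single when_def in_keys_iff)
  then have "\<phi> v = \<phi> (\<Sum>j\<in>Poly_Mapping.keys v. Poly_Mapping.single j (Poly_Mapping.lookup v j))"
    by (rule arg_cong)
  also have "\<dots> = (\<Sum>j\<in>Poly_Mapping.keys v. laurent_scale scale (Poly_Mapping.single j 1)
      (\<phi> (Poly_Mapping.single 0 (Poly_Mapping.lookup v j))))"
    unfolding sum by (rule sum.cong[OF refl], subst decomp, rule scale)
  finally show ?thesis
    by (simp add: lookup_sum lookup_laurent_scale_single endo_coeff_def)
qed

lemma PPU_minus_laurent_neg:
  assumes "\<phi> \<in> PPU_minus scale b" "v \<in> laurent_neg"
  shows "\<phi> v \<in> laurent_neg"
proof -
  have hom: "module_hom (laurent_scale scale) (laurent_scale scale) \<phi>"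
    using assms(1) by (simp add: PPU_minus_def PPU_def PU_def)
  have "Poly_Mapping.lookup (\<phi> v) n = 0" if "0 < n" for n
    unfolding lookup_laurent_endo[OF hom]
  proof (rule sum.neutral, rule ballI)
    fix j assume "j \<in> Poly_Mapping.keys v"
    then have "Poly_Mapping.lookup v j \<noteq> 0"
      by (simp add: in_keys_iff)
    then have "\<not> 0 < j"
      using assms(2) unfolding laurent_neg_def by blast
    then have "0 < n - j" using \<open>0 < n\<close> by simp
    then have "endo_coeff \<phi> (n - j) = (\<lambda>_. 0)"
      using assms(1) by (simp add: PPU_minus_def)
    then show "endo_coeff \<phi> (n - j) (Poly_Mapping.lookup v j) = 0"
      by simp
  qed
  then show ?thesis by (simp add: laurent_neg_def)
qed

end

lemma abs_voplus_eq_iff: "abs_voplus v = abs_voplus w \<longleftrightarrow> v - w \<in> laurent_neg"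
  by (rule voplus.abs_eq_iff)

lemma rep_abs_voplus: "rep_voplus (abs_voplus v) - v \<in> laurent_neg"
  using abs_voplus_eq_iff Quotient3_abs_rep[OF Quotient3_voplus] by metis

lemma voplus_map_abs:
  assumes hom: "\<And>v w. \<phi> (v - w) = \<phi> v - \<phi> w"
    and neg: "\<And>v. v \<in> laurent_neg \<Longrightarrow> \<phi> v \<in> laurent_neg"
  shows "voplus_map \<phi> (abs_voplus v) = abs_voplus (\<phi> v)"
  using neg[OF rep_abs_voplus[of v]] by (simp add: voplus_map_def abs_voplus_eq_iff hom)

lemma poly_to_laurent_pCons:
  "poly_to_laurent (pCons a p) =
    Poly_Mapping.single 0 a + Poly_Mapping.single (- 1) 1 * poly_to_laurent p"
  by (simp add: poly_to_laurent_def map_poly_pCons)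

lemma poly_to_laurent_0: "poly_to_laurent 0 = 0"
  by (simp add: poly_to_laurent_def)

lemma poly_to_laurent_1: "poly_to_laurent 1 = 1"
  unfolding one_pCons by (simp add: poly_to_laurent_pCons poly_to_laurent_0)

lemma poly_to_laurent_add: "poly_to_laurent (p + q) = poly_to_laurent p + poly_to_laurent q"
proof (induction p q rule: poly_induct2)
  case (pCons a p b q)
  then show ?case by (simp add: poly_to_laurent_pCons single_add algebra_simps)
qed (simp add: poly_to_laurent_0)

lemma poly_to_laurent_smult: "poly_to_laurent (smult a p) = Poly_Mapping.single 0 a * poly_to_laurent p"
proof (induction p)
  case (pCons b p)
  then show ?case by (simp add: poly_to_laurent_pCons mult_single algebra_simps)
qed (simp add: poly_to_laurent_0)

lemma poly_to_laurent_mult: "poly_to_laurent (p * q) = poly_to_laurent p * poly_to_laurent q"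
proof (induction p)
  case (pCons a p)
  then show ?case
    by (simp add: poly_to_laurent_pCons poly_to_laurent_add poly_to_laurent_smult algebra_simps)
qed (simp add: poly_to_laurent_0)

lemma lookup_poly_to_laurent:
  "Poly_Mapping.lookup (poly_to_laurent p) n = (if n \<le> 0 then coeff p (nat (- n)) else 0)"
proof (induction p arbitrary: n)
  case (pCons a p)
  have "Poly_Mapping.lookup (Poly_Mapping.single (- 1) 1 * q) n = Poly_Mapping.lookup q (n + 1)"
    for q :: "int \<Rightarrow>\<^sub>0 'a"
  proof (induction q rule: update_induct)
    case (update q j c)
    have "Poly_Mapping.lookup (Poly_Mapping.single (- 1) 1 * Poly_Mapping.single j c) n =
      Poly_Mapping.lookup (Poly_Mapping.single j c) (n + 1)"
      by (auto simp: mult_single lookup_single when_def)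
    with update show ?case
      by (simp add: poly_mapping_update_add lookup_add distrib_left)
  qed simp
  moreover have "nat (- n - 1) = m" if "nat (- n) = Suc m" for m
    using that by simp
  ultimately show ?case
    using pCons by (auto simp: poly_to_laurent_pCons lookup_add lookup_single when_def coeff_pCons
        split: nat.split)
qed (simp add: poly_to_laurent_0)

context vector_space
begin

lemma laurent_scale_neg:
  assumes "v \<in> laurent_neg"
  shows "laurent_scale scale (poly_to_laurent p) v \<in> laurent_neg"
  unfolding laurent_neg_def
proof (intro CollectI allI impI, subst lookup_laurent_scale[OF finite_keys subset_refl],
    rule sum.neutral, rule ballI)
  fix n i :: int assume "0 < n" "i \<in> Poly_Mapping.keys (poly_to_laurent p)"
  then have "n - i > 0" by (auto simp: in_keys_iff lookup_poly_to_laurent split: if_splits)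
  with assms show "scale (Poly_Mapping.lookup (poly_to_laurent p) i) (Poly_Mapping.lookup v (n - i)) = 0"
    by (simp add: laurent_neg_def)
qed

lemma voplus_scale_abs:
  "voplus_scale scale p (abs_voplus v) = abs_voplus (laurent_scale scale (poly_to_laurent p) v)"
proof -
  interpret L: module "laurent_scale scale" by (rule module_laurent_scale)
  show ?thesis
    using laurent_scale_neg[OF rep_abs_voplus[of v], of p]
    by (simp add: voplus_scale_def abs_voplus_eq_iff L.scale_right_diff_distrib)
qed

lemma module_voplus_scale: "module (voplus_scale scale)"
proof -
  interpret L: module "laurent_scale scale" by (rule module_laurent_scale)
  have abs: "\<exists>v. x = abs_voplus v" for x :: "'b voplus"
    by (metis Quotient3_abs_rep[OF Quotient3_voplus])
  show ?thesis
  proof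
    fix p q :: "'a poly" and x y :: "'b voplus"
    obtain v w where [simp]: "x = abs_voplus v" "y = abs_voplus w" using abs by metis
    show "voplus_scale scale p (x + y) = voplus_scale scale p x + voplus_scale scale p y"
      by (simp add: voplus_scale_abs plus_voplus.abs_eq L.scale_right_distrib)
    show "voplus_scale scale (p + q) x = voplus_scale scale p x + voplus_scale scale q x"
      by (simp add: voplus_scale_abs plus_voplus.abs_eq L.scale_left_distrib poly_to_laurent_add)
    show "voplus_scale scale p (voplus_scale scale q x) = voplus_scale scale (p * q) x"
      by (simp add: voplus_scale_abs poly_to_laurent_mult)
    show "voplus_scale scale 1 x = x"
      by (simp add: voplus_scale_abs poly_to_laurent_1)
  qed
qed

lemma voplus_map_PPU_minus:
  assumes "\<phi> \<in> PPU_minus scale b"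
  shows "voplus_map \<phi> (abs_voplus v) = abs_voplus (\<phi> v)"
proof -
  interpret module_hom "laurent_scale scale" "laurent_scale scale" \<phi>
    using assms by (simp add: PPU_minus_def PPU_def PU_def)
  show ?thesis
    by (rule voplus_map_abs[OF diff PPU_minus_laurent_neg[OF assms]])
qed

lemma module_hom_voplus_map:
  assumes "\<phi> \<in> PPU_minus scale b"
  shows "module_hom (voplus_scale scale) (voplus_scale scale) (voplus_map \<phi>)"
proof -
  interpret module_hom "laurent_scale scale" "laurent_scale scale" \<phi>
    using assms by (simp add: PPU_minus_def PPU_def PU_def)
  interpret V: module "voplus_scale scale" by (rule module_voplus_scale)
  have abs: "\<exists>v. x = abs_voplus v" for x :: "'b voplus"
    by (metis Quotient3_abs_rep[OF Quotient3_voplus])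
  show ?thesis
  proof
    fix p :: "'a poly" and x y :: "'b voplus"
    obtain v w where [simp]: "x = abs_voplus v" "y = abs_voplus w" using abs by metis
    show "voplus_map \<phi> (x + y) = voplus_map \<phi> x + voplus_map \<phi> y"
      by (simp add: voplus_map_PPU_minus[OF assms] plus_voplus.abs_eq add)
    show "voplus_map \<phi> (voplus_scale scale p x) = voplus_scale scale p (voplus_map \<phi> x)"
      by (simp add: voplus_map_PPU_minus[OF assms] voplus_scale_abs scale)
  qed
qed

end

end

theory Submission
  imports Defs
begin

text \<open>
  A paraunitary \<open>\<phi>\<close> is determined by the lattice \<open>M = \<phi>\<^sup>-\<^sup>1 V[t\<^sup>-\<^sup>1] \<supseteq> V[t\<^sup>-\<^sup>1]\<close>, the preimage of
  \<open>\<Omega>(\<phi>)\<close>, and divisibility is inclusion of lattices. To recover \<open>\<phi>\<close> from \<open>M\<close>, let \<open>\<beta>(v,w)\<close> be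
  the constant coefficient of the Laurent form and \<open>W = M \<inter> (t\<^sup>-\<^sup>1 M)\<^sup>\<bottom>\<close> with respect to \<open>\<beta>\<close>.
  The Laurent form is anisotropic because \<open>b\<close> is, whence \<open>M = W \<oplus> t\<^sup>-\<^sup>1 M\<close> as in a Wold decomposition
  and \<open>M = k[t\<^sup>-\<^sup>1] W\<close>. The Laurent form is constant on \<open>W\<close>, so evaluation at \<open>t = 1\<close> is an isometry
  \<open>W \<rightarrow> V\<close>; it is bijective, and the \<open>k[t,t\<^sup>-\<^sup>1]\<close>-linear extension of its inverse is \<open>\<phi>\<^sup>-\<^sup>1\<close>.
\<close>

abbreviation "lookup \<equiv> Poly_Mapping.lookup"
abbreviation "keys \<equiv> Poly_Mapping.keys"
abbreviation "single \<equiv> Poly_Mapping.single"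

section \<open>Finitely supported functions and bilinear forms\<close>

lemma poly_mapping_sum_singles: "(v :: 'i \<Rightarrow>\<^sub>0 'm::comm_monoid_add) = (\<Sum>j\<in>keys v. single j (lookup v j))"
  by (rule poly_mapping_eqI) (auto simp: lookup_sum lookup_single when_def in_keys_iff)

text \<open>The case \<open>single\<close> covers just the monomials occurring in \<open>v\<close>,
  so that conditions on the support of \<open>v\<close>, such as membership in
  \<open>laurent_neg\<close>, remain available there.\<close>

lemma poly_mapping_add_induct [case_names zero single add]:
  fixes v :: "'i \<Rightarrow>\<^sub>0 'm::comm_monoid_add"
  assumes "P 0" "\<And>i. i \<in> keys v \<Longrightarrow> P (single i (lookup v i))"
    and "\<And>x y. P x \<Longrightarrow> P y \<Longrightarrow> P (x + y)"
  shows "P v"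
proof -
  have "P (\<Sum>j\<in>A. single j (lookup v j))" if "A \<subseteq> keys v" for A
    using finite_subset[OF that finite_keys] that
    by (induction A rule: finite_induct) (auto simp: assms)
  then show ?thesis
    by (subst poly_mapping_sum_singles) simp
qed


lemma (in vector_space) bilinear_formD:
  assumes "bilinear_form scale \<beta>"
  shows "\<beta> (x + y) z = \<beta> x z + \<beta> y z" "\<beta> z (x + y) = \<beta> z x + \<beta> z y"
    "\<beta> (x - y) z = \<beta> x z - \<beta> y z" "\<beta> z (x - y) = \<beta> z x - \<beta> z y"
    "\<beta> 0 z = 0" "\<beta> z 0 = 0"
    "\<beta> (scale c x) z = c * \<beta> x z" "\<beta> z (scale c x) = c * \<beta> z x"
    "\<beta> (\<Sum>i\<in>A. f i) z = (\<Sum>i\<in>A. \<beta> (f i) z)" "\<beta> z (\<Sum>i\<in>A. f i) = (\<Sum>i\<in>A. \<beta> z (f i))"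
proof -
  interpret r: Vector_Spaces.linear scale "(*)" "\<lambda>y. \<beta> x y" for x
    using assms by (simp add: bilinear_form_def)
  interpret l: Vector_Spaces.linear scale "(*)" "\<lambda>x. \<beta> x y" for y
    using assms by (simp add: bilinear_form_def)
  show "\<beta> (x + y) z = \<beta> x z + \<beta> y z" "\<beta> z (x + y) = \<beta> z x + \<beta> z y"
    "\<beta> (x - y) z = \<beta> x z - \<beta> y z" "\<beta> z (x - y) = \<beta> z x - \<beta> z y"
    "\<beta> 0 z = 0" "\<beta> z 0 = 0"
    "\<beta> (scale c x) z = c * \<beta> x z" "\<beta> z (scale c x) = c * \<beta> z x"
    "\<beta> (\<Sum>i\<in>A. f i) z = (\<Sum>i\<in>A. \<beta> (f i) z)" "\<beta> z (\<Sum>i\<in>A. f i) = (\<Sum>i\<in>A. \<beta> z (f i))"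
    by (simp_all only: l.add r.add l.diff r.diff l.zero r.zero l.scale r.scale l.sum r.sum)
qed


section \<open>Orthogonal projection onto a finite-dimensional subspace\<close>

lemma linear_functionalD:
  assumes "Vector_Spaces.linear scale (*) f"
  shows "f (x + y) = f x + f y" "f (x - y) = f x - f y" "f (scale c x) = c * f x"
proof -
  interpret Vector_Spaces.linear scale "(*)" f by fact
  show "f (x + y) = f x + f y" "f (x - y) = f x - f y" "f (scale c x) = c * f x"
    by (rule add diff scale)+
qed

text \<open>A functional that vanishes on the common kernel of finitely many others is a linear
  combination of them. By induction on the family: a new \<open>f i\<close> either vanishes on the
  common kernel of the others within \<open>U\<close>, and then gets coefficient 0, or it is nonzero
  at some \<open>u0\<close> there, and its coefficient is read off at \<open>u0\<close>.\<close>

lemma (in vector_space) functional_in_span: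
  fixes f :: "'i \<Rightarrow> 'b \<Rightarrow> 'a"
  assumes "finite I" "subspace U"
    and f: "\<And>i. Vector_Spaces.linear scale (*) (f i)"
    and "Vector_Spaces.linear scale (*) g"
    and "\<And>u. u \<in> U \<Longrightarrow> (\<And>i. i \<in> I \<Longrightarrow> f i u = 0) \<Longrightarrow> g u = 0"
  shows "\<exists>c. \<forall>u\<in>U. g u = (\<Sum>i\<in>I. c i * f i u)"
  using assms(1,4,5)
proof (induction I arbitrary: g rule: finite_induct)
  case empty
  show ?case
    unfolding sum.empty using empty(2) by blast
next
  case (insert i I)
  note f_simps = linear_functionalD[OF f] and g_simps = linear_functionalD[OF insert.prems(1)]
  show ?case
  proof (cases "\<exists>u0\<in>U. (\<forall>j\<in>I. f j u0 = 0) \<and> f i u0 \<noteq> 0")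
    case True
    then obtain u0 where u0: "u0 \<in> U" "\<And>j. j \<in> I \<Longrightarrow> f j u0 = 0" "f i u0 \<noteq> 0" by blast
    let ?g = "\<lambda>u. g u - g u0 / f i u0 * f i u"
    have lin: "Vector_Spaces.linear scale (*) ?g"
      unfolding Vector_Spaces.linear_iff
    proof (intro conjI allI)
      show "vector_space scale" by (rule vector_space_axioms)
      show "vector_space ((*) :: 'a \<Rightarrow> _)"
        using insert.prems(1) unfolding Vector_Spaces.linear_iff by (elim conjE)
    qed (simp_all only: f_simps g_simps right_diff_distrib distrib_left diff_add_eq
        add_diff_eq diff_diff_eq mult.left_commute add.assoc add.commute add.left_commute)
    have "?g u = 0" if "u \<in> U" "\<And>j. j \<in> I \<Longrightarrow> f j u = 0" for u
    proof -
      \<comment> \<open>Removing this multiple of \<open>u0\<close> puts \<open>u\<close> into the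
        kernel of \<open>f i\<close> as well, without leaving the kernels of the
        \<open>f j\<close>.\<close>
      let ?u = "u - scale (f i u / f i u0) u0"
      have "?u \<in> U"
        using that u0 assms(2) by (intro subspace_diff subspace_scale)
      moreover have "f j ?u = 0" if "j \<in> insert i I" for j
        using that u0 \<open>\<And>j. j \<in> I \<Longrightarrow> f j u = 0\<close> by (auto simp: f_simps)
      ultimately have "g ?u = 0" by (rule insert.prems(2))
      then show ?thesis by (simp add: g_simps)
    qed
    from insert.IH[OF lin this] obtain c where c: "\<And>u. u \<in> U \<Longrightarrow> ?g u = (\<Sum>i\<in>I. c i * f i u)"
      by blast
    have "g u = (\<Sum>j\<in>insert i I. (c(i := g u0 / f i u0)) j * f j u)" if "u \<in> U" for u
    proof -
      have "(\<Sum>j\<in>I. (c(i := g u0 / f i u0)) j * f j u) = (\<Sum>i\<in>I. c i * f i u)"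
        using insert.hyps by (intro sum.cong) auto
      then show ?thesis
        using c[OF that] insert.hyps by (simp add: algebra_simps)
    qed
    then show ?thesis by blast
  next
    case False
    then have "g u = 0" if "u \<in> U" "\<And>j. j \<in> I \<Longrightarrow> f j u = 0" for u
      using insert.prems(2)[OF that(1)] that by blast
    from insert.IH[OF insert.prems(1) this]
    obtain c where c: "\<And>u. u \<in> U \<Longrightarrow> g u = (\<Sum>i\<in>I. c i * f i u)"
      by blast
    have "g u = (\<Sum>j\<in>insert i I. (c(i := 0)) j * f j u)" if "u \<in> U" for u
    proof -
      have "(\<Sum>j\<in>I. (c(i := 0)) j * f j u) = (\<Sum>i\<in>I. c i * f i u)"
        using insert.hyps by (intro sum.cong) auto
      then show ?thesis
        using c[OF that] insert.hyps by simp
    qed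
    then show ?thesis by blast
  qed
qed

text \<open>The ambient space may be infinite-dimensional. By nondegeneracy on \<open>U\<close>, the
  functionals \<beta> v for \<open>v\<close> in a finite basis \<open>B\<close> of \<open>U\<close>
  have common kernel 0 in \<open>U\<close>. Hence \<beta> x restricted to \<open>U\<close> is a
  combination of them, and its coefficients give the projection of \<open>x\<close>.\<close>

lemma (in vector_space) orthogonal_projection_exists:
  assumes \<beta>: "bilinear_form scale \<beta>"
    and U: "subspace U" and F: "finite F" "U \<subseteq> span F"
    and nondeg: "\<And>u. u \<in> U \<Longrightarrow> (\<And>v. v \<in> U \<Longrightarrow> \<beta> v u = 0) \<Longrightarrow> u = 0"
  shows "\<exists>u\<in>U. \<forall>v\<in>U. \<beta> (x - u) v = 0"
proof -
  obtain B where B: "B \<subseteq> U" "independent B" "U \<subseteq> span B"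
    by (rule maximal_independent_subset)
  have fin: "finite B"
    using independent_span_bound[OF F(1) B(2)] B(1) F(2) by blast
  have lin: "Vector_Spaces.linear scale (*) (\<beta> v)" for v
    using \<beta> by (simp add: bilinear_form_def)
  have "\<beta> x u = 0" if u: "u \<in> U" "\<And>v. v \<in> B \<Longrightarrow> \<beta> v u = 0" for u
  proof -
    have "\<beta> v u = 0" if "v \<in> span B" for v
      using that
    proof (induction rule: span_induct_alt)
      case base
      show ?case by (rule bilinear_formD(5)[OF \<beta>])
    next
      case (step c x y)
      then show ?case by (simp only: bilinear_formD[OF \<beta>] u(2)) simp
    qed
    with B(3) have "u = 0" by (intro nondeg u(1)) blast
    then show ?thesis by (simp add: bilinear_formD[OF \<beta>])
  qed
  from functional_in_span[of B U \<beta> "\<beta> x", OF fin U lin lin this]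
  obtain c where c: "\<And>u. u \<in> U \<Longrightarrow> \<beta> x u = (\<Sum>v\<in>B. c v * \<beta> v u)"
    by blast
  show ?thesis
  proof (intro bexI[of _ "\<Sum>v\<in>B. scale (c v) v"] ballI)
    show "(\<Sum>v\<in>B. scale (c v) v) \<in> U"
      using B(1) by (intro subspace_sum subspace_scale U) blast
    show "\<beta> (x - (\<Sum>v\<in>B. scale (c v) v)) u = 0" if "u \<in> U" for u
      by (simp only: bilinear_formD[OF \<beta>] c[OF that] diff_self)
  qed
qed

section \<open>Modular lattices of subgroups\<close>

lemma partial_orderI:
  assumes "\<And>x. x \<in> A \<Longrightarrow> r x x"
    and "\<And>x y. x \<in> A \<Longrightarrow> y \<in> A \<Longrightarrow> r x y \<Longrightarrow> r y x \<Longrightarrow> x = y"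
    and "\<And>x y z. x \<in> A \<Longrightarrow> y \<in> A \<Longrightarrow> z \<in> A \<Longrightarrow> r x y \<Longrightarrow> r y z \<Longrightarrow> r x z"
  shows "partial_order \<lparr>carrier = A, eq = (=), le = r\<rparr>" (is "partial_order ?L")
proof unfold_locales
  fix x y z assume "x \<in> carrier ?L" "y \<in> carrier ?L" "z \<in> carrier ?L" "x \<sqsubseteq>\<^bsub>?L\<^esub> y" "y \<sqsubseteq>\<^bsub>?L\<^esub> z"
  then show "x \<sqsubseteq>\<^bsub>?L\<^esub> z" using assms(3)[of x y z] by simp
qed (simp_all add: assms(1,2))

text \<open>\<open>F\<close> embeds the order into the subgroups of an abelian group, with an image
  closed under intersections and sums. These are then the meets and joins, and the modular law is
  Dedekind's law for subgroups.\<close>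

lemma modular_latticeI:
  fixes F :: "'x \<Rightarrow> 'g::ab_group_add set"
  assumes inj: "inj_on F A"
    and le: "\<And>x y. x \<in> A \<Longrightarrow> y \<in> A \<Longrightarrow> r x y \<longleftrightarrow> F x \<subseteq> F y"
    and zero: "\<And>x. x \<in> A \<Longrightarrow> 0 \<in> F x"
    and add: "\<And>x v w. x \<in> A \<Longrightarrow> v \<in> F x \<Longrightarrow> w \<in> F x \<Longrightarrow> v + w \<in> F x"
    and diff: "\<And>x v w. x \<in> A \<Longrightarrow> v \<in> F x \<Longrightarrow> w \<in> F x \<Longrightarrow> v - w \<in> F x"
    and inter: "\<And>x y. x \<in> A \<Longrightarrow> y \<in> A \<Longrightarrow> \<exists>z\<in>A. F z = F x \<inter> F y"
    and sum: "\<And>x y. x \<in> A \<Longrightarrow> y \<in> A \<Longrightarrow> \<exists>z\<in>A. F z = {v + w |v w. v \<in> F x \<and> w \<in> F y}"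
  shows "modular_lattice \<lparr>carrier = A, eq = (=), le = r\<rparr>"
proof -
  let ?L = "\<lparr>carrier = A, eq = (=), le = r\<rparr>"
  interpret partial_order ?L
  proof (rule partial_orderI)
    show "r x x" if "x \<in> A" for x using le[OF that that] by simp
    show "x = y" if "x \<in> A" "y \<in> A" "r x y" "r y x" for x y
      using that le[of x y] le[of y x] by (intro inj_onD[OF inj]) auto
    show "r x z" if "x \<in> A" "y \<in> A" "z \<in> A" "r x y" "r y z" for x y z
      using that le[of x y] le[of y z] le[of x z] by blast
  qed
  have Upper: "Upper ?L {x, y} = {u \<in> A. F x \<subseteq> F u \<and> F y \<subseteq> F u}"
    and Lower: "Lower ?L {x, y} = {u \<in> A. F u \<subseteq> F x \<and> F u \<subseteq> F y}" if "x \<in> A" "y \<in> A" for x y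
  proof -
    have "Upper ?L {x, y} = {u \<in> A. r x u \<and> r y u}" "Lower ?L {x, y} = {u \<in> A. r u x \<and> r u y}"
      using that unfolding Upper_def Lower_def by auto
    then show "Upper ?L {x, y} = {u \<in> A. F x \<subseteq> F u \<and> F y \<subseteq> F u}"
      and "Lower ?L {x, y} = {u \<in> A. F u \<subseteq> F x \<and> F u \<subseteq> F y}"
      using that by (simp_all add: le cong: conj_cong)
  qed
  have least: "least ?L z (Upper ?L {x, y})"
    if xyz: "x \<in> A" "y \<in> A" "z \<in> A" and F: "F z = {v + w |v w. v \<in> F x \<and> w \<in> F y}" for x y z
  proof -
    have "F x \<subseteq> F z"
    proof
      fix v assume "v \<in> F x"
      then have "v + 0 \<in> F z" unfolding F using zero xyz by blast
      then show "v \<in> F z" by simp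
    qed
    moreover have "F y \<subseteq> F z"
    proof
      fix v assume "v \<in> F y"
      then have "0 + v \<in> F z" unfolding F using zero xyz by blast
      then show "v \<in> F z" by simp
    qed
    moreover have "F z \<subseteq> F u" if "u \<in> A" "F x \<subseteq> F u" "F y \<subseteq> F u" for u
      unfolding F using add[OF that(1)] that by blast
    ultimately show ?thesis
      using xyz le[OF xyz(3)] unfolding least_def Upper[OF xyz(1,2)] by simp
  qed
  have greatest: "greatest ?L z (Lower ?L {x, y})"
    if xyz: "x \<in> A" "y \<in> A" "z \<in> A" and F: "F z = F x \<inter> F y" for x y z
    using xyz le[OF _ xyz(3)] F unfolding greatest_def Lower[OF xyz(1,2)] by simp
  interpret lattice ?L
  proof unfold_locales
    fix x y assume "x \<in> carrier ?L" "y \<in> carrier ?L"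
    then have xy: "x \<in> A" "y \<in> A" by simp_all
    show "\<exists>s. least ?L s (Upper ?L {x, y})"
      using sum[OF xy] least[OF xy] by (elim bexE) (rule exI)
    show "\<exists>s. greatest ?L s (Lower ?L {x, y})"
      using inter[OF xy] greatest[OF xy] by (elim bexE) (rule exI)
  qed
  have join: "x \<squnion>\<^bsub>?L\<^esub> y \<in> A" "F (x \<squnion>\<^bsub>?L\<^esub> y) = {v + w |v w. v \<in> F x \<and> w \<in> F y}"
    if xy: "x \<in> A" "y \<in> A" for x y
  proof -
    obtain z where z: "z \<in> A" "F z = {v + w |v w. v \<in> F x \<and> w \<in> F y}"
      using sum[OF xy] by blast
    have "x \<squnion>\<^bsub>?L\<^esub> y = z"
      by (rule joinI) (use least_unique[OF _ least[OF xy z]] xy in simp_all)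
    with z show "x \<squnion>\<^bsub>?L\<^esub> y \<in> A" "F (x \<squnion>\<^bsub>?L\<^esub> y) = {v + w |v w. v \<in> F x \<and> w \<in> F y}"
      by simp_all
  qed
  have meet: "x \<sqinter>\<^bsub>?L\<^esub> y \<in> A" "F (x \<sqinter>\<^bsub>?L\<^esub> y) = F x \<inter> F y" if xy: "x \<in> A" "y \<in> A" for x y
  proof -
    obtain z where z: "z \<in> A" "F z = F x \<inter> F y"
      using inter[OF xy] by blast
    have "x \<sqinter>\<^bsub>?L\<^esub> y = z"
      by (rule meetI) (use greatest_unique[OF _ greatest[OF xy z]] xy in simp_all)
    with z show "x \<sqinter>\<^bsub>?L\<^esub> y \<in> A" "F (x \<sqinter>\<^bsub>?L\<^esub> y) = F x \<inter> F y" by simp_all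
  qed
  show ?thesis
  proof unfold_locales
    fix x y z assume "x \<in> carrier ?L" "y \<in> carrier ?L" "z \<in> carrier ?L" "x \<sqsubseteq>\<^bsub>?L\<^esub> z"
    then have xyz: "x \<in> A" "y \<in> A" "z \<in> A" and xz: "F x \<subseteq> F z" using le[of x z] by simp_all
    have "F (x \<squnion>\<^bsub>?L\<^esub> (y \<sqinter>\<^bsub>?L\<^esub> z)) = F ((x \<squnion>\<^bsub>?L\<^esub> y) \<sqinter>\<^bsub>?L\<^esub> z)"
    proof (intro equalityI subsetI)
      fix u assume "u \<in> F (x \<squnion>\<^bsub>?L\<^esub> (y \<sqinter>\<^bsub>?L\<^esub> z))"
      then obtain v w where "u = v + w" "v \<in> F x" "w \<in> F y" "w \<in> F z"
        using xyz by (auto simp: join meet)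
      then show "u \<in> F ((x \<squnion>\<^bsub>?L\<^esub> y) \<sqinter>\<^bsub>?L\<^esub> z)"
        using add[OF xyz(3)] xz xyz by (auto simp: join meet)
    next
      fix u assume "u \<in> F ((x \<squnion>\<^bsub>?L\<^esub> y) \<sqinter>\<^bsub>?L\<^esub> z)"
      then obtain v w where u: "u = v + w" "v \<in> F x" "w \<in> F y" "u \<in> F z"
        using xyz by (auto simp: join meet)
      \<comment> \<open>The hypothesis that \<open>x\<close> lies below \<open>z\<close> enters
        here: it puts \<open>v\<close> into \<open>F z\<close>.\<close>
      then have "u - v \<in> F z" using diff[OF xyz(3)] xz by blast
      then have "w \<in> F z" using u(1) by simp
      then show "u \<in> F (x \<squnion>\<^bsub>?L\<^esub> (y \<sqinter>\<^bsub>?L\<^esub> z))"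
        using u xyz by (auto simp: join meet)
    qed
    then show "x \<squnion>\<^bsub>?L\<^esub> (y \<sqinter>\<^bsub>?L\<^esub> z) = (x \<squnion>\<^bsub>?L\<^esub> y) \<sqinter>\<^bsub>?L\<^esub> z"
      by (rule inj_onD[OF inj]) (simp_all add: join meet xyz)
  qed
qed

section \<open>Evaluation at one and shifts\<close>

definition ev1 :: "(int \<Rightarrow>\<^sub>0 'm::comm_monoid_add) \<Rightarrow> 'm"
  where "ev1 v = Sum_any (lookup v)"

lemma ev1_add: "ev1 (v + w) = ev1 v + ev1 w"
  unfolding ev1_def lookup_add by (rule Sum_any.distrib) simp_all

lemma ev1_single [simp]: "ev1 (single i x) = x"
  unfolding ev1_def
  by (subst Sum_any.expand_superset[of "{i}"]) (auto simp: lookup_single when_def)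

lemma ev1_0 [simp]: "ev1 0 = 0"
  by (simp add: ev1_def)

lemma ev1_uminus: "ev1 (- v) = - ev1 v" for v :: "int \<Rightarrow>\<^sub>0 'm::ab_group_add"
  using ev1_add[of v "- v"] by (simp add: eq_neg_iff_add_eq_0 add.commute)

lemma ev1_diff: "ev1 (v - w) = ev1 v - ev1 w" for v :: "int \<Rightarrow>\<^sub>0 'm::ab_group_add"
  using ev1_add[of v "- w"] by (simp add: ev1_uminus)

lemma ev1_sum: "ev1 (\<Sum>j\<in>A. f j) = (\<Sum>j\<in>A. ev1 (f j))"
  by (induction A rule: infinite_finite_induct) (simp_all add: ev1_add)

lemma ev1_superset: "finite A \<Longrightarrow> keys v \<subseteq> A \<Longrightarrow> ev1 v = (\<Sum>i\<in>A. lookup v i)"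
  unfolding ev1_def by (rule Sum_any.expand_superset) (auto simp: in_keys_iff)

lemma endo_at_one_ev1: "endo_at_one \<phi> x = ev1 (\<phi> (single 0 x))"
  by (simp add: endo_at_one_def endo_coeff_def ev1_def)

lemma abs_voplus_surj: "\<exists>v. x = abs_voplus v"
  by (metis Quotient3_abs_rep[OF Quotient3_voplus])

lemma abs_voplus_eq_0_iff: "abs_voplus v = 0 \<longleftrightarrow> v \<in> laurent_neg"
  by (simp add: zero_voplus.abs_eq abs_voplus_eq_iff)

lemma keys_laurent_neg: "v \<in> laurent_neg \<Longrightarrow> i \<in> keys v \<Longrightarrow> i \<le> 0"
  by (rule ccontr) (simp add: laurent_neg_def in_keys_iff)

lemma poly_to_laurent_monom: "poly_to_laurent (monom c n) = single (- int n) c"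
  by (rule poly_mapping_eqI) (auto simp: lookup_poly_to_laurent lookup_single when_def)

locale anisotropic_space = finite_dimensional_vector_space scale Basis
  for scale :: "'a::field \<Rightarrow> 'b::ab_group_add \<Rightarrow> 'b" and Basis +
  fixes b :: "'b \<Rightarrow> 'b \<Rightarrow> 'a"
  assumes bilinear: "bilinear_form scale b"
    and symmetric: "symmetric_form b"
    and anisotropic: "anisotropic b"
begin


definition tshift :: "int \<Rightarrow> (int \<Rightarrow>\<^sub>0 'b) \<Rightarrow> (int \<Rightarrow>\<^sub>0 'b)"
  where "tshift n = laurent_scale scale (single n 1)"

text \<open>This action makes the Laurent vectors a vector space over \<open>k\<close>, to which the
  results on orthogonal projection apply.\<close>

definition kmult :: "'a \<Rightarrow> (int \<Rightarrow>\<^sub>0 'b) \<Rightarrow> (int \<Rightarrow>\<^sub>0 'b)"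
  where "kmult c = laurent_scale scale (single 0 c)"

lemma lookup_tshift [simp]: "lookup (tshift n v) i = lookup v (i - n)"
  by (simp add: tshift_def lookup_laurent_scale_single)

lemma lookup_kmult [simp]: "lookup (kmult c v) i = scale c (lookup v i)"
  by (simp add: kmult_def lookup_laurent_scale_single)

lemma tshift_add: "tshift n (v + w) = tshift n v + tshift n w"
  and tshift_diff: "tshift n (v - w) = tshift n v - tshift n w"
  and tshift_0 [simp]: "tshift n 0 = 0"
  and tshift_tshift [simp]: "tshift m (tshift n v) = tshift (m + n) v"
  and tshift_zero [simp]: "tshift 0 v = v"
  and tshift_kmult: "tshift n (kmult c v) = kmult c (tshift n v)"
  by (auto intro!: poly_mapping_eqI simp: lookup_add lookup_minus algebra_simps)

lemma tshift_single [simp]: "tshift n (single i x) = single (n + i) x"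
  by (rule poly_mapping_eqI) (auto simp: lookup_single when_def)

lemma kmult_single [simp]: "kmult c (single i x) = single i (scale c x)"
  by (rule poly_mapping_eqI) (auto simp: lookup_single when_def)

lemma ev1_tshift [simp]: "ev1 (tshift n v) = ev1 v"
  by (induction v rule: poly_mapping_add_induct) (simp_all add: tshift_add ev1_add)

lemma vector_space_kmult: "vector_space kmult"
  by unfold_locales
    (auto intro!: poly_mapping_eqI simp: lookup_add scale_right_distrib scale_left_distrib)

lemma kmult_zero [simp]: "kmult c 0 = 0"
  by (rule poly_mapping_eqI) simp

lemma kmult_add: "kmult c (v + w) = kmult c v + kmult c w"
  by (rule poly_mapping_eqI) (simp add: lookup_add scale_right_distrib)

lemma ev1_kmult: "ev1 (kmult c v) = scale c (ev1 v)"
  by (induction v rule: poly_mapping_add_induct)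
    (simp_all add: kmult_add ev1_add scale_right_distrib)

lemma laurent_scale_single_left:
  "laurent_scale scale (single n c) v = kmult c (tshift n v)"
  by (rule poly_mapping_eqI) (simp add: lookup_laurent_scale_single)

text \<open>Laurent polynomials are sums of monomials, and a monomial acts as a shift followed by
  \<open>kmult\<close>.\<close>

lemma laurent_module_homI:
  assumes add: "\<And>v w. \<phi> (v + w) = \<phi> v + \<phi> w"
    and kmult: "\<And>c v. \<phi> (kmult c v) = kmult c (\<phi> v)"
    and tshift: "\<And>n v. \<phi> (tshift n v) = tshift n (\<phi> v)"
  shows "module_hom (laurent_scale scale) (laurent_scale scale) \<phi>"
proof -
  interpret L: module "laurent_scale scale" by (rule module_laurent_scale)
  have "\<phi> (laurent_scale scale p v) = laurent_scale scale p (\<phi> v)" for p v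
  proof (induction p rule: poly_mapping_add_induct)
    case zero
    show ?case
      using add[of 0 0] by simp
  next
    case (single i)
    show ?case
      by (simp add: laurent_scale_single_left kmult tshift)
  next
    case (add p q)
    then show ?case
      by (simp add: L.scale_left_distrib assms(1))
  qed
  then show ?thesis
    by unfold_locales (simp_all add: add)
qed

section \<open>The scalar part of the Laurent form\<close>

text \<open>A \<open>k\<close>-valued symmetric form for which all shifts are isometries. It carries
  the whole Laurent form, whose coefficient at \<open>n\<close> is the pairing with the first
  argument shifted by \<open>n\<close>.\<close>

definition pairing :: "(int \<Rightarrow>\<^sub>0 'b) \<Rightarrow> (int \<Rightarrow>\<^sub>0 'b) \<Rightarrow> 'a"
  where "pairing v w = lookup (laurent_form b v w) 0"

lemma b_commute: "b x y = b y x"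
  using symmetric by (simp add: symmetric_form_def)

lemma b_self_eq_0: "b x x = 0 \<longleftrightarrow> x = 0"
  using anisotropic by (simp add: anisotropic_def)

lemmas b_simps = bilinear_formD[OF bilinear]

lemma b_0 [simp]: "b 0 x = 0" "b x 0 = 0"
  by (rule b_simps)+

lemma pairing_eq: "pairing v w = (\<Sum>i\<in>keys w. b (lookup v i) (lookup w i))"
  by (simp add: pairing_def lookup_laurent_form[OF bilinear])

lemma pairing_superset:
  assumes "finite A" "keys w \<subseteq> A"
  shows "pairing v w = (\<Sum>i\<in>A. b (lookup v i) (lookup w i))"
  unfolding pairing_eq using assms by (intro sum.mono_neutral_left) (auto simp: in_keys_iff)

lemma lookup_laurent_form_pairing: "lookup (laurent_form b v w) n = pairing (tshift n v) w"
  by (simp add: pairing_eq lookup_laurent_form[OF bilinear])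

lemma pairing_commute: "pairing v w = pairing w v"
  using pairing_superset[of "keys v \<union> keys w" w v] pairing_superset[of "keys v \<union> keys w" v w]
  by (simp add: b_commute)

lemma pairing_add_left: "pairing (v + v') w = pairing v w + pairing v' w"
  by (simp only: pairing_eq lookup_add b_simps sum.distrib)

lemma pairing_kmult_left: "pairing (kmult c v) w = c * pairing v w"
  by (simp only: pairing_eq lookup_kmult b_simps sum_distrib_left)

lemma bilinear_form_pairing: "bilinear_form kmult pairing"
proof -
  have "pairing w (v + v') = pairing w v + pairing w v'" for v v' w
    by (metis pairing_add_left pairing_commute)
  moreover have "pairing w (kmult c v) = c * pairing w v" for c v w
    by (metis pairing_kmult_left pairing_commute)
  moreover have "vector_space ((*) :: 'a \<Rightarrow> _)"
    using bilinear unfolding bilinear_form_def Vector_Spaces.linear_iff by blast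
  ultimately show ?thesis
    unfolding bilinear_form_def Vector_Spaces.linear_iff
    by (intro conjI allI vector_space_kmult pairing_add_left pairing_kmult_left)
qed

lemmas pairing_simps = vector_space.bilinear_formD[OF vector_space_kmult bilinear_form_pairing]

lemma pairing_0 [simp]: "pairing 0 v = 0" "pairing v 0 = 0"
  by (rule pairing_simps)+

lemma pairing_single_right [simp]: "pairing v (single j x) = b (lookup v j) x"
  by (subst pairing_superset[of "{j}"]) auto

lemma pairing_single_left [simp]: "pairing (single j x) v = b x (lookup v j)"
  by (metis pairing_single_right pairing_commute b_commute)

lemma pairing_tshift [simp]: "pairing (tshift n v) (tshift n w) = pairing v w"
  by (induction w rule: poly_mapping_add_induct) (simp_all add: tshift_add pairing_simps(2))

lemma pairing_tshift_left: "pairing (tshift n v) w = pairing v (tshift (- n) w)"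
  using pairing_tshift[of n v "tshift (- n) w"] by simp

lemma laurent_form_add:
  "laurent_form b (v + v') w = laurent_form b v w + laurent_form b v' w"
  "laurent_form b w (v + v') = laurent_form b w v + laurent_form b w v'"
  by (rule poly_mapping_eqI,
      simp only: lookup_add lookup_laurent_form_pairing tshift_add pairing_simps)+

lemma laurent_form_single: "laurent_form b (single i u) (single j v) = single (j - i) (b u v)"
  by (rule poly_mapping_eqI)
    (auto simp: lookup_laurent_form_pairing lookup_single when_def)

lemma laurent_form_0: "laurent_form b 0 w = 0" "laurent_form b w 0 = 0"
  by (rule poly_mapping_eqI, simp add: lookup_laurent_form_pairing)+

text \<open>Both sides are biadditive, so monomials suffice; for these, evaluation at one forgets
  the exponent \<open>j - i\<close> of the Laurent form.\<close>

lemma b_ev1: "b (ev1 x) (ev1 y) = ev1 (laurent_form b x y)"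
proof (induction x rule: poly_mapping_add_induct)
  case (single i)
  show ?case
    by (induction y rule: poly_mapping_add_induct)
      (simp_all add: laurent_form_0 laurent_form_single laurent_form_add ev1_add b_simps(2))
qed (simp_all add: laurent_form_0 laurent_form_add ev1_add b_simps(1))

text \<open>Division by \<open>t - 1\<close>: the coefficients of the quotient are the negated
  partial sums of those of \<open>x\<close>. They vanish from \<open>a + int N\<close> on because
  the total sum is 0, so the quotient fits into an interval shorter by one.\<close>

lemma ev1_eq_0_imp_divisible:
  fixes x :: "int \<Rightarrow>\<^sub>0 'b"
  assumes "ev1 x = 0" "keys x \<subseteq> {a..<a + int (Suc N)}"
  obtains y where "x = tshift 1 y - y" "keys y \<subseteq> {a..<a + int N}"
proof -
  let ?S = "\<lambda>i. \<Sum>j\<in>{a..i}. lookup x j"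
  let ?y = "\<Sum>i\<in>{a..<a + int N}. single i (- ?S i)"
  have "?S i = 0" if "i \<ge> a + int N" for i
    using that assms by (subst ev1_superset[of "{a..i}", symmetric]) auto
  then have y: "lookup ?y i = - ?S i" for i
    by (auto simp: lookup_sum lookup_single when_def sum.delta not_le not_less)
  have "?S i - ?S (i - 1) = lookup x i" for i
  proof (cases "a \<le> i")
    case True
    then have "{a..i} = insert i {a..i - 1}" by auto
    then show ?thesis by simp
  next
    case False
    then have "i \<notin> keys x" using assms(2) by auto
    with False show ?thesis by (simp add: in_keys_iff)
  qed
  then have "x = tshift 1 ?y - ?y"
    by (intro poly_mapping_eqI) (simp only: lookup_minus lookup_tshift y, simp)
  moreover have "keys ?y \<subseteq> {a..<a + int N}"
    by (rule subset_trans[OF keys_sum]) auto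
  ultimately show thesis by (rule that)
qed

text \<open>If \<open>x \<noteq> 0\<close> were isotropic, \<open>x(1)\<close> would be isotropic for \<open>b\<close>, so \<open>x = (t - 1) y\<close>
  with \<open>y\<close> isotropic and shorter.\<close>

lemma laurent_form_anisotropic:
  assumes "\<And>n. pairing (tshift n x) x = 0"
  shows "x = 0"
proof -
  have "x = 0" if "keys x \<subseteq> {a..<a + int N}" "\<And>n. pairing (tshift n x) x = 0" for a N x
    using that
  proof (induction N arbitrary: x)
    case 0
    then show ?case by simp
  next
    case (Suc N)
    have "laurent_form b x x = 0"
      by (rule poly_mapping_eqI) (simp add: lookup_laurent_form_pairing Suc.prems(2))
    then have "ev1 x = 0"
      using b_ev1[of x x] by (simp add: b_self_eq_0)
    then obtain y where y: "x = tshift 1 y - y" "keys y \<subseteq> {a..<a + int N}"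
      using Suc.prems(1) by (rule ev1_eq_0_imp_divisible)
    define q where "q = laurent_form b y y"
    have q: "lookup q n = pairing (tshift n y) y" for n
      by (simp add: q_def lookup_laurent_form_pairing)
    \<comment> \<open>Since \<open>x = (t - 1) y\<close>, the Laurent form of \<open>x\<close> is
      \<open>(2 - t - t^-1) q\<close>. The left-hand side is its coefficient at
      \<open>n\<close>.\<close>
    have rec: "lookup q n - lookup q (n - 1) - (lookup q (n + 1) - lookup q n) = 0" for n
    proof -
      have shift: "pairing (tshift m y) (tshift 1 y) = pairing (tshift (m - 1) y) y" for m
        using pairing_tshift[of 1 "tshift (m - 1) y" y] by simp
      have "0 = pairing (tshift n x) x" by (simp only: Suc.prems(2))
      also have "\<dots> = pairing (tshift (n + 1) y - tshift n y) (tshift 1 y - y)"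
        by (simp only: y(1) tshift_diff tshift_tshift)
      also have "\<dots> = lookup q n - lookup q (n - 1) - (lookup q (n + 1) - lookup q n)"
        by (simp only: pairing_simps(3,4) shift q add_diff_cancel_right' diff_diff_eq2)
      finally show ?thesis by (rule sym)
    qed
    have "q = 0"
    proof (rule ccontr)
      assume "q \<noteq> 0"
      then have ne: "keys q \<noteq> {}" by simp
      define n where "n = Max (keys q)"
      have "lookup q m = 0" if "m > n" for m
      proof (rule ccontr)
        assume "lookup q m \<noteq> 0"
        then have "m \<le> n" unfolding n_def by (intro Max_ge) (simp_all add: in_keys_iff)
        with that show False by simp
      qed
      \<comment> \<open>One place above the top exponent of \<open>q\<close>, only the term with
        coefficient -1 survives, whatever the characteristic.\<close>
      then have "lookup q n = 0" using rec[of "n + 1"] by simp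
      moreover have "n \<in> keys q" unfolding n_def by (rule Max_in) (use ne in auto)
      ultimately show False by (simp add: in_keys_iff)
    qed
    then have "y = 0"
      using Suc.IH[OF y(2)] q by simp
    with y(1) show ?case by simp
  qed
  moreover have "\<exists>a N. keys x \<subseteq> {a..<a + int N}"
  proof (intro exI subsetI)
    fix i assume "i \<in> keys x"
    then have "Min (keys x) \<le> i" "i \<le> Max (keys x)" by auto
    then show "i \<in> {Min (keys x)..<Min (keys x) + int (nat (Max (keys x) - Min (keys x) + 1))}"
      by auto
  qed
  ultimately show ?thesis using assms by blast
qed


section \<open>Lattices containing the negative part\<close>

text \<open>These are the preimages in \<open>V[t,t^-1]\<close> of the finitely generated submodules
  of the quotient. Finite generation is expressed by a common upper bound on the exponents.\<close>

definition neg_lattice :: "(int \<Rightarrow>\<^sub>0 'b) set \<Rightarrow> bool"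
  where "neg_lattice M \<longleftrightarrow> laurent_neg \<subseteq> M \<and> (\<forall>v\<in>M. \<forall>w\<in>M. v + w \<in> M) \<and>
    (\<forall>c. \<forall>v\<in>M. kmult c v \<in> M) \<and> (\<forall>v\<in>M. tshift (- 1) v \<in> M) \<and>
    (\<exists>K. \<forall>v\<in>M. \<forall>i>K. lookup v i = 0)"

lemma neg_latticeD:
  assumes "neg_lattice M"
  shows "laurent_neg \<subseteq> M" "\<And>v w. v \<in> M \<Longrightarrow> w \<in> M \<Longrightarrow> v + w \<in> M"
    "\<And>c v. v \<in> M \<Longrightarrow> kmult c v \<in> M" "\<And>v. v \<in> M \<Longrightarrow> tshift (- 1) v \<in> M"
  using assms by (auto simp: neg_lattice_def)

lemma neg_lattice_bound:
  assumes "neg_lattice M"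
  obtains K :: nat where "\<And>v i. v \<in> M \<Longrightarrow> i > int K \<Longrightarrow> lookup v i = 0"
proof -
  obtain K where K: "\<And>v i. v \<in> M \<Longrightarrow> i > K \<Longrightarrow> lookup v i = 0"
    using assms unfolding neg_lattice_def by blast
  show thesis
    by (rule that[of "nat K"]) (use K in \<open>auto split: if_splits\<close>)
qed

lemma neg_lattice_0: "neg_lattice M \<Longrightarrow> 0 \<in> M"
  using neg_latticeD(1) laurent_neg_zero by blast

lemma neg_lattice_diff:
  assumes "neg_lattice M" "v \<in> M" "w \<in> M"
  shows "v - w \<in> M"
proof -
  have "v - w = v + kmult (- 1) w"
    by (rule poly_mapping_eqI) (simp add: lookup_add lookup_minus)
  then show ?thesis using neg_latticeD(2,3)[OF assms(1)] assms(2,3) by metis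
qed

lemma neg_lattice_tshift:
  assumes "neg_lattice M" "v \<in> M"
  shows "tshift (- int k) v \<in> M"
proof (induction k)
  case (Suc k)
  then have "tshift (- 1) (tshift (- int k) v) \<in> M" by (rule neg_latticeD[OF assms(1)])
  then show ?case by simp
qed (simp add: assms)

text \<open>Such a \<open>u\<close> is isotropic: it is orthogonal to all \<open>t\<^sup>-\<^sup>j u\<close> and hence, by symmetry, to all \<open>t\<^sup>j u\<close>.\<close>

lemma orthogonal_to_neg_lattice_eq_0:
  assumes M: "neg_lattice M" and u: "u \<in> M" "\<And>m. m \<in> M \<Longrightarrow> pairing m u = 0"
  shows "u = 0"
proof (rule laurent_form_anisotropic)
  fix n :: int
  have neg: "pairing (tshift (- int k) u) u = 0" for k
    by (intro u(2) neg_lattice_tshift M u(1))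
  show "pairing (tshift n u) u = 0"
  proof (cases "n \<le> 0")
    case True
    then show ?thesis using neg[of "nat (- n)"] by simp
  next
    case False
    then have "pairing u (tshift (- n) u) = 0"
      using neg[of "nat n"] by (simp add: pairing_commute)
    then show ?thesis by (simp add: pairing_tshift_left)
  qed
qed

lemma laurent_split:
  "\<exists>v1 v2. v = v1 + v2 \<and> v1 \<in> laurent_neg \<and> (\<forall>i\<le>0. lookup (v2 :: int \<Rightarrow>\<^sub>0 'b) i = 0)"
proof -
  let ?v1 = "\<Sum>i\<in>{i\<in>keys v. i \<le> 0}. single i (lookup v i)"
  have l: "lookup ?v1 i = (if i \<le> 0 then lookup v i else 0)" for i
    by (auto simp: lookup_sum lookup_single when_def in_keys_iff)
  show ?thesis
    by (rule exI[of _ ?v1], rule exI[of _ "v - ?v1"])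
      (simp add: l laurent_neg_def lookup_minus)
qed

lemma pairing_neg_pos:
  assumes "v \<in> laurent_neg" "\<And>i. i \<le> 0 \<Longrightarrow> lookup w i = 0"
  shows "pairing v w = 0"
proof -
  have "lookup v i = 0 \<or> lookup w i = 0" for i
    using assms by (cases "i \<le> 0") (auto simp: laurent_neg_def)
  then show ?thesis
    unfolding pairing_eq by (intro sum.neutral) (metis b_0)
qed

text \<open>\<open>M\<close> is the orthogonal sum of \<open>V[t^-1]\<close> and the space
  \<open>?U\<close> of its members with positive exponents, which is finite-dimensional because the
  exponents are at most \<open>K\<close>. The nonpositive part of \<open>x\<close> already lies in
  \<open>M\<close>; the positive part is projected onto \<open>?U\<close>.\<close>

lemma neg_lattice_projection:
  assumes M: "neg_lattice M"
  shows "\<exists>u\<in>M. \<forall>m\<in>M. pairing m (x - u) = 0"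
proof -
  interpret KV: vector_space kmult by (rule vector_space_kmult)
  obtain K where K: "\<And>v i. v \<in> M \<Longrightarrow> i > int K \<Longrightarrow> lookup v i = 0"
    using M by (rule neg_lattice_bound) blast
  let ?U = "{u\<in>M. \<forall>i\<le>0. lookup u i = 0}"
  let ?F = "(\<lambda>(i, e). single i e) ` ({1..int K} \<times> Basis)"
  \<comment> \<open>For a vector \<open>y\<close> with positive exponents, orthogonality to
    \<open>?U\<close> implies orthogonality to all of \<open>M\<close>. This transfers nondegeneracy
    from \<open>M\<close> to \<open>?U\<close>.\<close>
  have pos: "pairing m y = 0"
    if "\<And>i. i \<le> 0 \<Longrightarrow> lookup y i = 0" "\<And>u. u \<in> ?U \<Longrightarrow> pairing u y = 0" "m \<in> M" for y m
  proof -
    obtain m1 m2 where m: "m = m1 + m2" "m1 \<in> laurent_neg" "\<And>i. i \<le> 0 \<Longrightarrow> lookup m2 i = 0"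
      using laurent_split[of m] by blast
    have "m2 = m - m1" using m(1) by simp
    then have "m2 \<in> ?U"
      using neg_lattice_diff[OF M that(3)] neg_latticeD(1)[OF M] m(2,3) by auto
    then show ?thesis
      using that(2) pairing_neg_pos[OF m(2) that(1)] by (simp add: m(1) pairing_simps(1))
  qed
  have sub: "KV.subspace ?U"
    by (intro KV.subspaceI)
      (auto simp: neg_lattice_0[OF M] neg_latticeD[OF M] lookup_add)
  have span: "?U \<subseteq> KV.span ?F"
  proof
    fix u assume u: "u \<in> ?U"
    have "single i y \<in> KV.span ?F" if "i \<in> {1..int K}" for i y
    proof -
      have "y \<in> span Basis" by (simp add: span_Basis)
      then show ?thesis
      proof (induction rule: span_induct_alt)
        case base
        show ?case by (simp add: KV.span_zero)
      next
        case (step c e y)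
        have "single i e \<in> ?F"
          using that step.hyps by force
        then have "kmult c (single i e) + single i y \<in> KV.span ?F"
          by (rule KV.span_add[OF KV.span_scale[OF KV.span_base] step.IH])
        then show ?case by (simp add: single_add)
      qed
    qed
    moreover have "i \<in> {1..int K}" if "i \<in> keys u" for i
    proof -
      have "lookup u i \<noteq> 0" using that by (simp add: in_keys_iff)
      then have "\<not> i \<le> 0" "\<not> i > int K" using u K[of u i] by blast+
      then show ?thesis by simp
    qed
    ultimately show "u \<in> KV.span ?F"
      by (subst poly_mapping_sum_singles) (intro KV.span_sum, blast)
  qed
  obtain x1 x2 where x: "x = x1 + x2" "x1 \<in> laurent_neg" "\<And>i. i \<le> 0 \<Longrightarrow> lookup x2 i = 0"
    using laurent_split[of x] by blast
  have nondeg: "u = 0" if "u \<in> ?U" "\<And>v. v \<in> ?U \<Longrightarrow> pairing v u = 0" for u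
    by (rule orthogonal_to_neg_lattice_eq_0[OF M]) (use that pos[of u] in auto)
  have "finite ?F" by (simp add: finite_Basis)
  from KV.orthogonal_projection_exists[OF bilinear_form_pairing sub this span nondeg, of x2]
  obtain u where u: "u \<in> ?U" "\<And>v. v \<in> ?U \<Longrightarrow> pairing (x2 - u) v = 0" by blast
  show ?thesis
  proof (intro bexI ballI)
    show "x1 + u \<in> M" using u(1) x(2) neg_latticeD[OF M] by blast
    fix m assume m: "m \<in> M"
    have "pairing m (x2 - u) = 0"
    proof (rule pos[OF _ _ m])
      show "lookup (x2 - u) i = 0" if "i \<le> 0" for i
        using that u(1) x(3) by (simp add: lookup_minus)
      show "pairing v (x2 - u) = 0" if "v \<in> ?U" for v
        using u(2)[OF that] by (simp add: pairing_commute)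
    qed
    then show "pairing m (x - (x1 + u)) = 0"
      by (simp add: x(1))
  qed
qed

section \<open>Paraunitary maps\<close>

lemma PU_simps:
  assumes "\<phi> \<in> PU scale b"
  shows "\<phi> (v + w) = \<phi> v + \<phi> w" "\<phi> (v - w) = \<phi> v - \<phi> w" "\<phi> 0 = 0"
    "\<phi> (kmult c v) = kmult c (\<phi> v)" "\<phi> (tshift n v) = tshift n (\<phi> v)"
    "pairing (\<phi> v) (\<phi> w) = pairing v w"
proof -
  interpret module_hom "laurent_scale scale" "laurent_scale scale" \<phi>
    using assms by (simp add: PU_def)
  show "\<phi> (v + w) = \<phi> v + \<phi> w" "\<phi> (v - w) = \<phi> v - \<phi> w" "\<phi> 0 = 0"
    by (rule add diff zero)+
  show "\<phi> (kmult c v) = kmult c (\<phi> v)" "\<phi> (tshift n v) = tshift n (\<phi> v)"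
    unfolding kmult_def tshift_def by (rule scale)+
  show "pairing (\<phi> v) (\<phi> w) = pairing v w"
    using assms by (simp add: PU_def pairing_def)
qed

lemma PU_bij: "\<phi> \<in> PU scale b \<Longrightarrow> bij \<phi>"
  by (simp add: PU_def)

lemma PU_inv_simps:
  assumes "\<phi> \<in> PU scale b"
  shows "inv \<phi> (\<phi> v) = v" "\<phi> (inv \<phi> v) = v"
  using PU_bij[OF assms] by (simp_all add: bij_is_inj bij_is_surj surj_f_inv_f)

lemma PU_I:
  assumes "\<And>v w. \<phi> (v + w) = \<phi> v + \<phi> w" "\<And>c v. \<phi> (kmult c v) = kmult c (\<phi> v)"
    and tshift: "\<And>n v. \<phi> (tshift n v) = tshift n (\<phi> v)"
    and "bij \<phi>" and pairing: "\<And>v w. pairing (\<phi> v) (\<phi> w) = pairing v w"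
  shows "\<phi> \<in> PU scale b"
proof -
  have "laurent_form b (\<phi> v) (\<phi> w) = laurent_form b v w" for v w
    by (rule poly_mapping_eqI)
      (simp only: lookup_laurent_form_pairing tshift[symmetric] pairing)
  then show ?thesis
    using assms by (simp add: PU_def laurent_module_homI)
qed

lemma PU_inv:
  assumes "\<phi> \<in> PU scale b"
  shows "inv \<phi> \<in> PU scale b"
proof (rule PU_I)
  have inj: "x = y" if "\<phi> x = \<phi> y" for x y
    using that PU_bij[OF assms] by (simp add: bij_is_inj inj_eq)
  show "inv \<phi> (v + w) = inv \<phi> v + inv \<phi> w" for v w
    by (rule inj) (simp only: PU_simps[OF assms] PU_inv_simps[OF assms])
  show "inv \<phi> (kmult c v) = kmult c (inv \<phi> v)" for c v
    by (rule inj) (simp only: PU_simps[OF assms] PU_inv_simps[OF assms])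
  show "inv \<phi> (tshift n v) = tshift n (inv \<phi> v)" for n v
    by (rule inj) (simp only: PU_simps[OF assms] PU_inv_simps[OF assms])
  show "bij (inv \<phi>)"
    by (rule bij_imp_bij_inv[OF PU_bij[OF assms]])
  show "pairing (inv \<phi> v) (inv \<phi> w) = pairing v w" for v w
    using PU_simps(6)[OF assms, of "inv \<phi> v" "inv \<phi> w"] by (simp only: PU_inv_simps[OF assms])
qed

lemma PU_comp:
  assumes "\<phi> \<in> PU scale b" "\<psi> \<in> PU scale b"
  shows "\<psi> \<circ> \<phi> \<in> PU scale b"
  by (rule PU_I) (simp_all add: PU_simps[OF assms(1)] PU_simps[OF assms(2)] bij_comp PU_bij assms)

text \<open>Being the identity at \<open>t = 1\<close> is a condition on constants. It extends to
  all monomials because evaluation at one ignores shifts, and then to all Laurent vectors by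
  additivity.\<close>

lemma PPU_iff: "\<phi> \<in> PPU scale b \<longleftrightarrow> \<phi> \<in> PU scale b \<and> (\<forall>v. ev1 (\<phi> v) = ev1 v)"
proof -
  have "ev1 (\<phi> v) = ev1 v" if "\<phi> \<in> PU scale b" "endo_at_one \<phi> = id" for v
  proof (induction v rule: poly_mapping_add_induct)
    case (single i)
    have "\<phi> (tshift i (single 0 (lookup v i))) = tshift i (\<phi> (single 0 (lookup v i)))"
      by (rule PU_simps[OF that(1)])
    then have "ev1 (\<phi> (single i (lookup v i))) = endo_at_one \<phi> (lookup v i)"
      by (simp add: endo_at_one_ev1)
    with that(2) show ?case by simp
  qed (simp_all add: PU_simps[OF that(1)] ev1_add)
  then show ?thesis
    unfolding PPU_def by (auto simp: endo_at_one_ev1 fun_eq_iff)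
qed

lemma PPU_inv: "\<phi> \<in> PPU scale b \<Longrightarrow> inv \<phi> \<in> PPU scale b"
  by (metis PPU_iff PU_inv PU_inv_simps(2))

lemma PPU_comp: "\<phi> \<in> PPU scale b \<Longrightarrow> \<psi> \<in> PPU scale b \<Longrightarrow> \<psi> \<circ> \<phi> \<in> PPU scale b"
  by (simp add: PPU_iff PU_comp)

text \<open>The coefficients of \<phi> are read off from the images of constants, which belong to
  \<open>laurent_neg\<close>.\<close>

lemma PPU_minus_iff:
  "\<phi> \<in> PPU_minus scale b \<longleftrightarrow> \<phi> \<in> PPU scale b \<and> (\<forall>v\<in>laurent_neg. \<phi> v \<in> laurent_neg)"
proof -
  have "endo_coeff \<phi> i = (\<lambda>_. 0)" if "\<forall>v\<in>laurent_neg. \<phi> v \<in> laurent_neg" "i > 0" for i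
  proof
    fix x :: 'b
    have "single 0 x \<in> laurent_neg" by (simp add: laurent_neg_def lookup_single when_def)
    with that show "endo_coeff \<phi> i x = 0" by (auto simp: endo_coeff_def laurent_neg_def)
  qed
  then show ?thesis
    using PPU_minus_laurent_neg unfolding PPU_minus_def by blast
qed


section \<open>The wandering subspace\<close>

text \<open>For \<open>M = \<phi>\<^sup>-\<^sup>1 V[t\<^sup>-\<^sup>1]\<close> with \<open>\<phi>\<close> paraunitary, this is \<open>\<phi>\<^sup>-\<^sup>1 V\<close>.\<close>

definition wandering :: "(int \<Rightarrow>\<^sub>0 'b) set \<Rightarrow> (int \<Rightarrow>\<^sub>0 'b) set"
  where "wandering M = {w \<in> M. \<forall>m\<in>M. pairing (tshift (- 1) m) w = 0}"

lemma wandering_closed: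
  assumes "neg_lattice M"
  shows "0 \<in> wandering M"
    "\<And>v w. v \<in> wandering M \<Longrightarrow> w \<in> wandering M \<Longrightarrow> v + w \<in> wandering M"
    "\<And>v w. v \<in> wandering M \<Longrightarrow> w \<in> wandering M \<Longrightarrow> v - w \<in> wandering M"
    "\<And>c v. v \<in> wandering M \<Longrightarrow> kmult c v \<in> wandering M"
  by (simp_all add: wandering_def neg_latticeD[OF assms] neg_lattice_0[OF assms]
      neg_lattice_diff[OF assms] pairing_simps(2,4,8))

text \<open>Let \<open>u\<close> be the projection of \<open>t v\<close> to \<open>M\<close>. As
  shifts are isometries, \<open>v - t^-1 u\<close> is orthogonal to \<open>t^-1 M\<close>.\<close>

lemma wandering_decomposition:
  assumes "neg_lattice M" "v \<in> M"
  shows "\<exists>w\<in>wandering M. \<exists>r\<in>M. v = w + tshift (- 1) r"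
proof -
  obtain u where u: "u \<in> M" "\<And>m. m \<in> M \<Longrightarrow> pairing m (tshift 1 v - u) = 0"
    using neg_lattice_projection[OF assms(1), of "tshift 1 v"] by blast
  have "pairing (tshift (- 1) m) (v - tshift (- 1) u) = 0" if "m \<in> M" for m
    using u(2)[OF that] by (simp add: pairing_tshift_left tshift_diff)
  then have "v - tshift (- 1) u \<in> wandering M"
    using assms u(1) by (simp add: wandering_def neg_latticeD neg_lattice_diff)
  then show ?thesis using u(1) by force
qed

lemma wandering_decomposition_iterated:
  assumes "neg_lattice M" "v \<in> M"
  shows "\<exists>f r. (\<forall>j. f j \<in> wandering M) \<and> r \<in> M \<and>
    v = (\<Sum>j<k. tshift (- int j) (f j)) + tshift (- int k) r"
proof (induction k)
  case 0
  show ?case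
    using assms(2) wandering_closed(1)[OF assms(1)]
    by (intro exI[of _ "\<lambda>_. 0"] exI[of _ v]) simp
next
  case (Suc k)
  then obtain f r where f: "\<And>j. f j \<in> wandering M" "r \<in> M"
    "v = (\<Sum>j<k. tshift (- int j) (f j)) + tshift (- int k) r" by blast
  obtain w r' where w: "w \<in> wandering M" "r' \<in> M" "r = w + tshift (- 1) r'"
    using wandering_decomposition[OF assms(1) f(2)] by blast
  let ?f = "f(k := w)"
  have "(\<Sum>j<k. tshift (- int j) (?f j)) = (\<Sum>j<k. tshift (- int j) (f j))"
    by (rule sum.cong) auto
  moreover have "tshift (- int k) (tshift (- 1) r') = tshift (- int (Suc k)) r'"
    by (simp add: algebra_simps)
  ultimately have "v = (\<Sum>j<Suc k. tshift (- int j) (?f j)) + tshift (- int (Suc k)) r'"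
    by (simp only: f(3) w(3) tshift_add add.assoc sum.lessThan_Suc fun_upd_same)
  moreover have "\<forall>j. ?f j \<in> wandering M" using f(1) w(1) by simp
  ultimately show ?case using w(2) by blast
qed

text \<open>The remainder of the iterated decomposition vanishes once it is orthogonal to \<open>t\<^sup>-\<^sup>k M\<close>.\<close>

lemma wandering_generates:
  assumes M: "neg_lattice M" and v: "v \<in> M"
  obtains f and k :: nat where "\<And>j. f j \<in> wandering M" "v = (\<Sum>j<k. tshift (- int j) (f j))"
proof -
  obtain K where K: "\<And>v i. v \<in> M \<Longrightarrow> i > int K \<Longrightarrow> lookup v i = 0"
    using M by (rule neg_lattice_bound) blast
  define a where "a = nat (- Min (insert 0 (keys v)))"
  have a: "lookup v i = 0" if "i < - int a" for i
  proof (rule ccontr)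
    assume "lookup v i \<noteq> 0"
    then have "Min (insert 0 (keys v)) \<le> i"
      by (intro Min_le) (simp_all add: in_keys_iff)
    with that show False unfolding a_def by linarith
  qed
  \<comment> \<open>Vectors in \<open>t^-k M\<close> have exponents at most
    \<open>K - k = - a - 1\<close>, just below the support of \<open>v\<close>, so they are
    orthogonal to \<open>v\<close>.\<close>
  define k where "k = K + a + 1"
  obtain f r where f: "\<And>j. f j \<in> wandering M" "r \<in> M"
    "v = (\<Sum>j<k. tshift (- int j) (f j)) + tshift (- int k) r"
    using wandering_decomposition_iterated[OF assms, of k] by blast
  have "pairing m r = 0" if m: "m \<in> M" for m
  proof -
    have "pairing (tshift (- int k) m) v = 0"
      unfolding pairing_eq
    proof (intro sum.neutral ballI)
      fix i assume "i \<in> keys v"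
      then have "\<not> i < - int a" using a[of i] by (auto simp: in_keys_iff)
      then have "lookup m (i + int k) = 0" by (intro K m) (simp add: k_def)
      then show "b (lookup (tshift (- int k) m) i) (lookup v i) = 0" by simp
    qed
    \<comment> \<open>For \<open>j < k\<close>, the shift by \<open>-k\<close> factors as the shift
      by \<open>-j\<close> after a shift landing in \<open>t^-1 M\<close>, to which
      \<open>f j\<close> is orthogonal.\<close>
    moreover have "pairing (tshift (- int k) m) (tshift (- int j) (f j)) = 0" if "j < k" for j
    proof -
      have "tshift (- int (k - j - 1)) m \<in> M" by (rule neg_lattice_tshift[OF M m])
      then have "pairing (tshift (- 1) (tshift (- int (k - j - 1)) m)) (f j) = 0"
        using f(1)[of j] unfolding wandering_def by blast
      then have "pairing (tshift (- int j) (tshift (- 1) (tshift (- int (k - j - 1)) m)))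
          (tshift (- int j) (f j)) = 0"
        by (simp only: pairing_tshift)
      moreover have "- int j + (- 1 + - int (k - j - 1)) = - int k"
        using that by simp
      ultimately show ?thesis by (simp only: tshift_tshift)
    qed
    moreover have "tshift (- int k) r = v - (\<Sum>j<k. tshift (- int j) (f j))"
      using f(3) by simp
    ultimately have "pairing (tshift (- int k) m) (tshift (- int k) r) = 0"
      by (simp add: pairing_simps(4,10))
    then show ?thesis by simp
  qed
  then have "r = 0" by (rule orthogonal_to_neg_lattice_eq_0[OF M f(2)])
  with f show thesis by (intro that[of f k]) simp_all
qed

text \<open>For negative \<open>n\<close> the shift of \<open>u\<close> lies in
  \<open>t^-1 M\<close>, to which \<open>w\<close> is orthogonal by definition. Positive
  \<open>n\<close> follows by exchanging \<open>u\<close> and \<open>w\<close>.\<close>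

lemma pairing_wandering_tshift:
  assumes M: "neg_lattice M" and "u \<in> wandering M" "w \<in> wandering M" "n \<noteq> 0"
  shows "pairing (tshift n u) w = 0"
proof -
  have neg: "pairing (tshift n u) w = 0" if "n < 0" "u \<in> wandering M" "w \<in> wandering M" for n u w
  proof -
    have "tshift (n + 1) u \<in> M"
      using neg_lattice_tshift[OF M, of u "nat (- n - 1)"] that
      by (simp add: wandering_def add.commute)
    then have "pairing (tshift (- 1) (tshift (n + 1) u)) w = 0"
      using that(3) unfolding wandering_def by blast
    then show ?thesis by simp
  qed
  show ?thesis
  proof (cases "n < 0")
    case False
    then have "pairing (tshift (- n) w) u = 0" using assms by (intro neg) auto
    then show ?thesis by (simp add: pairing_tshift_left[of n] pairing_commute[of u])
  qed (rule neg, use assms in auto)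
qed

text \<open>The Laurent form of two wandering vectors is constant, hence equal to its value at one,
  which \<open>b\<close> computes.\<close>

lemma pairing_wandering:
  assumes "neg_lattice M" "u \<in> wandering M" "w \<in> wandering M"
  shows "pairing u w = b (ev1 u) (ev1 w)"
proof -
  have "laurent_form b u w = single 0 (pairing u w)"
    using pairing_wandering_tshift[OF assms]
    by (intro poly_mapping_eqI) (simp add: lookup_laurent_form_pairing lookup_single when_def)
  then show ?thesis by (simp add: b_ev1)
qed

text \<open>A wandering vector with value 0 at one pairs to 0 with itself and with all its shifts,
  so anisotropy makes it 0.\<close>

lemma inj_on_ev1_wandering:
  assumes "neg_lattice M"
  shows "inj_on ev1 (wandering M)"
proof (rule inj_onI)
  fix u w assume uw: "u \<in> wandering M" "w \<in> wandering M" "ev1 u = ev1 w"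
  let ?d = "u - w"
  have d: "?d \<in> wandering M" using uw by (intro wandering_closed assms)
  have "pairing (tshift n ?d) ?d = 0" for n
    using pairing_wandering_tshift[OF assms d d, of n] pairing_wandering[OF assms d d] uw(3)
    by (cases "n = 0") (simp_all add: ev1_diff)
  then have "?d = 0" by (rule laurent_form_anisotropic)
  then show "u = w" by simp
qed

text \<open>The constant \<open>x\<close> lies in \<open>M\<close> and so is a sum of shifted
  wandering vectors. Evaluation at one removes the shifts.\<close>

lemma ev1_wandering_surj:
  assumes "neg_lattice M"
  shows "ev1 ` wandering M = UNIV"
proof (rule UNIV_eq_I[symmetric])
  fix x
  have "single 0 x \<in> M"
    using neg_latticeD(1)[OF assms] by (auto simp: laurent_neg_def lookup_single when_def)
  then obtain f and k :: nat
    where f: "\<And>j. f j \<in> wandering M" "single 0 x = (\<Sum>j<k. tshift (- int j) (f j))"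
    using wandering_generates[OF assms] by blast
  have "(\<Sum>j<n. f j) \<in> wandering M" for n :: nat
    by (induction n) (simp_all add: wandering_closed assms f(1))
  moreover have "x = ev1 (\<Sum>j<k. f j)"
    using arg_cong[OF f(2), of ev1] by (simp add: ev1_sum)
  ultimately show "x \<in> ev1 ` wandering M" by blast
qed

section \<open>The paraunitary map attached to a lattice\<close>

definition laurent_ext :: "('b \<Rightarrow> (int \<Rightarrow>\<^sub>0 'b)) \<Rightarrow> (int \<Rightarrow>\<^sub>0 'b) \<Rightarrow> (int \<Rightarrow>\<^sub>0 'b)"
  where "laurent_ext \<sigma> x = (\<Sum>j\<in>keys x. tshift j (\<sigma> (lookup x j)))"

lemma laurent_ext_add:
  assumes add: "\<And>x y. \<sigma> (x + y) = \<sigma> x + \<sigma> y"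
  shows "laurent_ext \<sigma> (x + y) = laurent_ext \<sigma> x + laurent_ext \<sigma> y"
    and laurent_ext_single: "laurent_ext \<sigma> (single j z) = tshift j (\<sigma> z)"
proof -
  have zero: "\<sigma> 0 = 0" using add[of 0 0] by simp
  have superset: "laurent_ext \<sigma> x = (\<Sum>j\<in>A. tshift j (\<sigma> (lookup x j)))"
    if "finite A" "keys x \<subseteq> A" for x A
    unfolding laurent_ext_def using that
    by (intro sum.mono_neutral_left) (auto simp: in_keys_iff zero)
  show "laurent_ext \<sigma> (x + y) = laurent_ext \<sigma> x + laurent_ext \<sigma> y"
    using Poly_Mapping.keys_add[of x y]
    by (simp add: superset[of "keys x \<union> keys y"] lookup_add add tshift_add sum.distrib)
  show "laurent_ext \<sigma> (single j z) = tshift j (\<sigma> z)"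
    by (subst superset[of "{j}"]) auto
qed

lemma paraunitary_of_neg_lattice:
  assumes M: "neg_lattice M"
  obtains \<phi> where "\<phi> \<in> PPU_minus scale b" "\<phi> -` laurent_neg = M"
proof -
  let ?W = "wandering M"
  define \<sigma> where "\<sigma> = inv_into ?W ev1"
  have \<sigma>: "\<sigma> x \<in> ?W" "ev1 (\<sigma> x) = x" for x
    using ev1_wandering_surj[OF M] unfolding \<sigma>_def by (auto intro: inv_into_into f_inv_into_f)
  \<comment> \<open>By injectivity on the wandering subspace, identities for \<sigma> can be checked
    after evaluation at one; this gives linearity.\<close>
  have \<sigma>_eqI: "\<sigma> x = w" if "w \<in> ?W" "ev1 w = x" for x w
    using inj_onD[OF inj_on_ev1_wandering[OF M] _ \<sigma>(1) that(1)] \<sigma>(2) that(2) by simp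
  have \<sigma>_add: "\<sigma> (x + y) = \<sigma> x + \<sigma> y" for x y
    by (rule \<sigma>_eqI) (simp_all add: wandering_closed M \<sigma> ev1_add)
  have \<sigma>_scale: "\<sigma> (scale c x) = kmult c (\<sigma> x)" for c x
    by (rule \<sigma>_eqI) (simp_all add: wandering_closed M \<sigma> ev1_kmult)
  define E where "E = laurent_ext \<sigma>"
  have E_add: "E (x + y) = E x + E y" for x y
    unfolding E_def by (rule laurent_ext_add[OF \<sigma>_add])
  have E_single: "E (single j x) = tshift j (\<sigma> x)" for j x
    unfolding E_def by (rule laurent_ext_single[OF \<sigma>_add])
  have E_0: "E 0 = 0" using E_add[of 0 0] by simp
  have E_sum: "E (\<Sum>j\<in>A. g j) = (\<Sum>j\<in>A. E (g j))" for A :: "nat set" and g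
    by (induction A rule: infinite_finite_induct) (simp_all add: E_0 E_add)
  have E_tshift: "E (tshift n x) = tshift n (E x)" for n x
    by (induction x rule: poly_mapping_add_induct) (simp_all add: E_0 E_add E_single tshift_add)
  have E_kmult: "E (kmult c x) = kmult c (E x)" for c x
    by (induction x rule: poly_mapping_add_induct)
      (simp_all add: E_0 E_add E_single kmult_add \<sigma>_scale tshift_kmult)
  have E_ev1: "ev1 (E x) = ev1 x" for x
    by (induction x rule: poly_mapping_add_induct) (simp_all add: E_0 E_add E_single ev1_add \<sigma>)
  \<comment> \<open>Distinct shifts of the wandering subspace are orthogonal, and evaluation at one
    is an isometry on it; hence \<open>E\<close> preserves the pairing of monomials.\<close>
  have \<sigma>_pairing: "pairing (tshift i (\<sigma> x)) (tshift j (\<sigma> y)) = pairing (single i x) (single j y)"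
    for i j x y
  proof -
    have "pairing (tshift i (\<sigma> x)) (tshift j (\<sigma> y)) = pairing (tshift (i - j) (\<sigma> x)) (\<sigma> y)"
      using pairing_tshift[of j "tshift (i - j) (\<sigma> x)" "\<sigma> y"] by simp
    also have "\<dots> = (if i = j then b x y else 0)"
      using pairing_wandering_tshift[OF M \<sigma>(1) \<sigma>(1), of "i - j"]
        pairing_wandering[OF M \<sigma>(1) \<sigma>(1)] by (simp add: \<sigma>)
    finally show ?thesis by (simp add: lookup_single when_def)
  qed
  have E_pairing: "pairing (E x) (E y) = pairing x y" for x y
  proof (induction x rule: poly_mapping_add_induct)
    case (single i)
    show ?case
      by (induction y rule: poly_mapping_add_induct)
        (simp_all only: E_0 pairing_0 E_add E_single \<sigma>_pairing pairing_simps(2))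
  qed (simp_all only: E_0 pairing_0 E_add pairing_simps(1))
  have M_E: "v \<in> E ` laurent_neg" if v: "v \<in> M" for v
  proof -
    obtain f and k :: nat where f: "\<And>j. f j \<in> ?W" "v = (\<Sum>j<k. tshift (- int j) (f j))"
      using wandering_generates[OF M v] by blast
    have "tshift (- int j) (f j) = E (single (- int j) (ev1 (f j)))" for j
      by (simp add: E_single \<sigma>_eqI[OF f(1)])
    then have "v = E (\<Sum>j<k. single (- int j) (ev1 (f j)))"
      by (simp add: f(2) E_sum)
    moreover have "(\<Sum>j<k. single (- int j) (ev1 (f j))) \<in> laurent_neg"
      by (simp add: laurent_neg_def lookup_sum lookup_single when_def)
    ultimately show ?thesis by blast
  qed
  have E_M: "E v \<in> M" if "v \<in> laurent_neg" for v
  proof (induction v rule: poly_mapping_add_induct)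
    case (single i)
    then have "lookup v i \<noteq> 0" by (simp add: in_keys_iff)
    then have "\<not> i > 0" using that unfolding laurent_neg_def by blast
    then have "tshift (- int (nat (- i))) (\<sigma> (lookup v i)) \<in> M"
      using \<sigma>(1) by (intro neg_lattice_tshift M) (simp add: wandering_def)
    then show ?case using \<open>\<not> i > 0\<close> by (simp add: E_single)
  qed (simp_all add: E_0 E_add neg_lattice_0 neg_latticeD M)
  \<comment> \<open>An isometry of an anisotropic form has trivial kernel.\<close>
  have "inj E"
  proof (rule injI)
    fix x y assume "E x = E y"
    have "E (x - y) + E y = E x" using E_add[of "x - y" y] by simp
    with \<open>E x = E y\<close> have E: "E (x - y) = 0" by simp
    have "pairing (tshift n (x - y)) (x - y) = 0" for n
      by (subst E_pairing[symmetric]) (simp add: E)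
    then have "x - y = 0" by (rule laurent_form_anisotropic)
    then show "x = y" by simp
  qed
  moreover have "surj E"
  proof -
    have "y \<in> range E" for y
    proof (induction y rule: poly_mapping_add_induct)
      case zero
      show ?case using E_0 by (metis rangeI)
    next
      case (single i)
      \<comment> \<open>Constants lie in \<open>M\<close> and thus in the range of \<open>E\<close>,
        which is stable under shifts and sums.\<close>
      have "single 0 (lookup y i) \<in> M"
        using neg_latticeD(1)[OF M] by (auto simp: laurent_neg_def lookup_single when_def)
      then obtain x where "single 0 (lookup y i) = E x" using M_E by blast
      then have "E (tshift i x) = single i (lookup y i)" by (simp add: E_tshift[of i x] flip: \<open>_ = E x\<close>)
      then show ?case by (metis rangeI)
    next
      case (add x y)
      then obtain x' y' where "x = E x'" "y = E y'" by blast
      then have "x + y = E (x' + y')" by (simp add: E_add)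
      then show ?case by blast
    qed
    then show ?thesis by blast
  qed
  ultimately have "bij E" by (simp add: bij_def)
  then have "E \<in> PPU scale b"
    using PU_I[of E] E_add E_kmult E_tshift E_pairing E_ev1 unfolding PPU_iff by blast
  then have PPU: "inv E \<in> PPU scale b" by (rule PPU_inv)
  have EM: "E ` laurent_neg = M" using E_M M_E by blast
  have vimage: "inv E -` laurent_neg = M"
    using \<open>bij E\<close> EM by (metis bij_betw_def bij_imp_bij_inv bij_vimage_eq_inv_image inv_inv_eq)
  have "inv E v \<in> laurent_neg" if "v \<in> laurent_neg" for v
    using that neg_latticeD(1)[OF M] vimage by blast
  then show thesis
    using PPU vimage by (intro that[of "inv E"]) (simp_all add: PPU_minus_iff)
qed

section \<open>The correspondence between paraunitary maps and submodules\<close>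

lemma kmult_laurent_neg: "v \<in> laurent_neg \<Longrightarrow> kmult c v \<in> laurent_neg"
  by (simp add: laurent_neg_def)

lemma tshift_laurent_neg: "v \<in> laurent_neg \<Longrightarrow> n \<le> 0 \<Longrightarrow> tshift n v \<in> laurent_neg"
  by (simp add: laurent_neg_def)

lemma PPU_minusD:
  assumes "\<phi> \<in> PPU_minus scale b"
  shows "\<phi> \<in> PPU scale b" "\<phi> \<in> PU scale b" "\<And>v. v \<in> laurent_neg \<Longrightarrow> \<phi> v \<in> laurent_neg"
  using assms by (auto simp: PPU_minus_iff PPU_iff)

text \<open>The images of the finitely many basis vectors bound the exponents on constants, and
  nonpositive powers of \<open>t\<close> do not raise them. Applied to \<open>inv \<phi>\<close>,
  this bounds the preimage of \<open>laurent_neg\<close> under \<phi>.\<close>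

lemma PU_bounded_on_neg:
  assumes \<psi>: "\<psi> \<in> PU scale b"
  shows "\<exists>K. \<forall>v\<in>laurent_neg. \<forall>i>K. lookup (\<psi> v) i = 0"
proof -
  define K where "K = Max (insert 0 (\<Union>e\<in>Basis. keys (\<psi> (single 0 e))))"
  have fin: "finite (insert 0 (\<Union>e\<in>Basis. keys (\<psi> (single 0 e))))"
    by (simp add: finite_Basis)
  have basis: "lookup (\<psi> (single 0 e)) i = 0" if "e \<in> Basis" "i > K" for e i
  proof (rule ccontr)
    assume "lookup (\<psi> (single 0 e)) i \<noteq> 0"
    then have "i \<le> K" unfolding K_def using that(1) by (intro Max_ge fin) (auto simp: in_keys_iff)
    with that(2) show False by simp
  qed
  have const: "lookup (\<psi> (single 0 x)) i = 0" if "i > K" for x i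
  proof -
    have "x \<in> span Basis" by (simp add: span_Basis)
    then show ?thesis
    proof (induction rule: span_induct_alt)
      case base
      show ?case by (simp add: PU_simps(3)[OF \<psi>])
    next
      case (step c e x)
      have "\<psi> (single 0 (scale c e + x)) = kmult c (\<psi> (single 0 e)) + \<psi> (single 0 x)"
        by (simp only: single_add PU_simps[OF \<psi>] flip: kmult_single)
      with step that show ?case by (simp add: lookup_add basis)
    qed
  qed
  have "lookup (\<psi> v) i = 0" if v: "v \<in> laurent_neg" and i: "i > K" for v i
  proof (induction v rule: poly_mapping_add_induct)
    case (single j)
    then have "j \<le> 0" by (rule keys_laurent_neg[OF v])
    have "\<psi> (tshift j (single 0 (lookup v j))) = tshift j (\<psi> (single 0 (lookup v j)))"
      by (rule PU_simps[OF \<psi>])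
    then show ?case using i \<open>j \<le> 0\<close> by (simp add: const)
  qed (simp_all add: PU_simps[OF \<psi>] lookup_add)
  then show ?thesis by blast
qed

lemma neg_lattice_vimage_PPU_minus:
  assumes "\<phi> \<in> PPU_minus scale b"
  shows "neg_lattice (\<phi> -` laurent_neg)"
proof -
  note \<phi> = PPU_minusD[OF assms]
  obtain K where K: "\<And>v i. v \<in> laurent_neg \<Longrightarrow> i > K \<Longrightarrow> lookup (inv \<phi> v) i = 0"
    using PU_bounded_on_neg[OF PU_inv[OF \<phi>(2)]] by blast
  have "lookup v i = 0" if "\<phi> v \<in> laurent_neg" "i > K" for v i
    using K[OF that] by (simp add: PU_inv_simps[OF \<phi>(2)])
  then show ?thesis
    unfolding neg_lattice_def
    using \<phi>(3) by (auto simp: PU_simps[OF \<phi>(2)] laurent_neg_add kmult_laurent_neg tshift_laurent_neg)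
qed

text \<open>The only possible quotient is \<open>\<psi> \<circ> inv \<phi>\<close>, and the
  inclusion says precisely that it preserves \<open>laurent_neg\<close>.\<close>

lemma right_divides_iff:
  assumes \<phi>: "\<phi> \<in> PPU_minus scale b" and \<psi>: "\<psi> \<in> PPU_minus scale b"
  shows "right_divides scale b \<phi> \<psi> \<longleftrightarrow> \<phi> -` laurent_neg \<subseteq> \<psi> -` laurent_neg"
proof
  assume "right_divides scale b \<phi> \<psi>"
  then show "\<phi> -` laurent_neg \<subseteq> \<psi> -` laurent_neg"
    unfolding right_divides_def using PPU_minusD(3) by fastforce
next
  assume sub: "\<phi> -` laurent_neg \<subseteq> \<psi> -` laurent_neg"
  note inv = PU_inv_simps[OF PPU_minusD(2)[OF \<phi>]]
  have "\<psi> \<circ> inv \<phi> \<in> PPU scale b"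
    using \<phi> \<psi> by (intro PPU_comp PPU_inv PPU_minusD)
  moreover have "\<psi> (inv \<phi> v) \<in> laurent_neg" if "v \<in> laurent_neg" for v
    using sub that inv(2)[of v] by auto
  ultimately have "\<psi> \<circ> inv \<phi> \<in> PPU_minus scale b" by (simp add: PPU_minus_iff)
  moreover have "\<psi> = (\<psi> \<circ> inv \<phi>) \<circ> \<phi>" by (simp add: fun_eq_iff inv)
  ultimately show "right_divides scale b \<phi> \<psi>"
    unfolding right_divides_def by blast
qed

text \<open>Such a \<open>\<chi>\<close> preserves \<open>V = V[t\<^sup>-\<^sup>1] \<inter> (t\<^sup>-\<^sup>1 V[t\<^sup>-\<^sup>1])\<^sup>\<bottom>\<close>, on which it equals \<open>\<chi>(1)\<close>.\<close>

lemma PPU_preserving_neg_eq_id: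
  assumes \<chi>: "\<chi> \<in> PPU scale b" and neg: "\<And>v. \<chi> v \<in> laurent_neg \<longleftrightarrow> v \<in> laurent_neg"
  shows "\<chi> = id"
proof
  have PU: "\<chi> \<in> PU scale b" and ev1: "\<And>v. ev1 (\<chi> v) = ev1 v"
    using \<chi> by (simp_all add: PPU_iff)
  note simps = PU_simps[OF PU] and inv = PU_inv_simps[OF PU]
  have single: "\<chi> (single 0 x) = single 0 x" for x
  proof -
    let ?y = "\<chi> (single 0 x)"
    have "?y \<in> laurent_neg"
      by (simp add: neg) (simp add: laurent_neg_def lookup_single when_def)
    moreover have "lookup ?y i = 0" if "i < 0" for i
    proof -
      \<comment> \<open>Chosen so that \<open>t^-1 ?m\<close> is the monomial of \<open>?y\<close>
        at \<open>i\<close>, whose pairing with \<open>?y\<close> is the value of \<open>b\<close>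
        on that coefficient. As \<open>i < 0\<close>, the exponent \<open>i + 1\<close> is still
        nonpositive.\<close>
      let ?m = "single (i + 1) (lookup ?y i)"
      have "?m \<in> laurent_neg" using that by (simp add: laurent_neg_def lookup_single when_def)
      then have m: "inv \<chi> ?m \<in> laurent_neg" using neg[of "inv \<chi> ?m"] by (simp add: inv)
      have "b (lookup ?y i) (lookup ?y i) = pairing (tshift (- 1) ?m) ?y" by simp
      also have "\<dots> = pairing (\<chi> (tshift (- 1) (inv \<chi> ?m))) ?y" by (simp only: simps inv)
      also have "\<dots> = pairing (tshift (- 1) (inv \<chi> ?m)) (single 0 x)" by (rule simps)
      \<comment> \<open>After the shift by -1 a member of \<open>laurent_neg\<close> has no constant
        term left.\<close>
      also have "\<dots> = 0" using m by (simp add: laurent_neg_def)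
      finally show ?thesis by (simp add: b_self_eq_0)
    qed
    ultimately have "lookup ?y i = 0" if "i \<noteq> 0" for i
      using that unfolding laurent_neg_def by (cases "i < 0") auto
    then have y: "?y = single 0 (lookup ?y 0)"
      by (intro poly_mapping_eqI) (auto simp: lookup_single when_def)
    then have "lookup ?y 0 = ev1 ?y" by (metis ev1_single)
    also have "\<dots> = x" by (simp add: ev1)
    finally show ?thesis using y by simp
  qed
  show "\<chi> v = id v" for v
  proof (induction v rule: poly_mapping_add_induct)
    case (single i)
    have "\<chi> (tshift i (single 0 (lookup v i))) = tshift i (single 0 (lookup v i))"
      by (simp only: simps \<open>\<And>x. \<chi> (single 0 x) = single 0 x\<close>)
    then show ?case by simp
  qed (simp_all add: simps)
qed

text \<open>If the preimages agree, \<open>\<psi> \<circ> inv \<phi>\<close> preserves membership in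
  \<open>laurent_neg\<close> in both directions and is therefore the identity.\<close>

lemma inj_on_vimage_neg: "inj_on (\<lambda>\<phi>. \<phi> -` laurent_neg) (PPU_minus scale b)"
proof (rule inj_onI)
  fix \<phi> \<psi> assume \<phi>: "\<phi> \<in> PPU_minus scale b" and \<psi>: "\<psi> \<in> PPU_minus scale b"
    and eq: "\<phi> -` laurent_neg = \<psi> -` laurent_neg"
  note inv = PU_inv_simps[OF PPU_minusD(2)[OF \<phi>]]
  have "(\<psi> \<circ> inv \<phi>) v \<in> laurent_neg \<longleftrightarrow> v \<in> laurent_neg" for v
    using eq inv(2)[of v] by (metis comp_apply vimage_eq)
  then have "\<psi> \<circ> inv \<phi> = id"
    using \<phi> \<psi> by (intro PPU_preserving_neg_eq_id PPU_comp PPU_inv PPU_minusD)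
  then have "\<psi> (inv \<phi> (\<phi> v)) = \<phi> v" for v by (simp add: fun_eq_iff)
  then show "\<phi> = \<psi>" by (simp add: inv fun_eq_iff)
qed

section \<open>Kernels on the quotient module\<close>

lemma abs_voplus_in_Omega_iff:
  assumes "\<phi> \<in> PPU_minus scale b"
  shows "abs_voplus v \<in> Omega \<phi> \<longleftrightarrow> v \<in> \<phi> -` laurent_neg"
  by (simp add: Omega_def voplus_map_PPU_minus[OF assms] abs_voplus_eq_0_iff)

lemma Omega_eq_image:
  assumes "\<phi> \<in> PPU_minus scale b"
  shows "Omega \<phi> = abs_voplus ` (\<phi> -` laurent_neg)"
proof (intro equalityI subsetI)
  fix x assume x: "x \<in> Omega \<phi>"
  obtain v where "x = abs_voplus v" using abs_voplus_surj by blast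
  with x show "x \<in> abs_voplus ` (\<phi> -` laurent_neg)"
    by (simp only: abs_voplus_in_Omega_iff[OF assms] imageI)
qed (auto simp: abs_voplus_in_Omega_iff[OF assms])

lemma Omega_mono_iff:
  assumes "\<phi> \<in> PPU_minus scale b" "\<psi> \<in> PPU_minus scale b"
  shows "Omega \<phi> \<subseteq> Omega \<psi> \<longleftrightarrow> \<phi> -` laurent_neg \<subseteq> \<psi> -` laurent_neg"
  unfolding Omega_eq_image[OF assms(1)] image_subset_iff abs_voplus_in_Omega_iff[OF assms(2)]
  by blast

text \<open>\<open>inv \<phi>\<close> maps \<open>V[t^-1]\<close> onto the lattice over the kernel,
  and \<open>Basis\<close> generates \<open>V[t^-1]\<close> over \<open>k[t^-1]\<close>. The classes
  of the images of the basis vectors therefore generate the kernel.\<close>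

lemma Omega_in_Sub_voplus:
  assumes "\<phi> \<in> PPU_minus scale b"
  shows "Omega \<phi> \<in> Sub_voplus scale"
proof -
  interpret V: module "voplus_scale scale" by (rule module_voplus_scale)
  interpret h: module_hom "voplus_scale scale" "voplus_scale scale" "voplus_map \<phi>"
    by (rule module_hom_voplus_map[OF assms])
  note PU = PPU_minusD(2)[OF assms]
  note simps = PU_simps[OF PU_inv[OF PU]] and inv = PU_inv_simps[OF PU]
  have sub: "V.subspace (Omega \<phi>)"
    unfolding Omega_def by (rule h.subspace_kernel)
  let ?S = "(\<lambda>e. abs_voplus (inv \<phi> (single 0 e))) ` Basis"
  have "V.span ?S = Omega \<phi>"
  proof (rule equalityI)
    have "single 0 e \<in> laurent_neg" for e :: 'b
      by (simp add: laurent_neg_def lookup_single when_def)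
    then have "?S \<subseteq> Omega \<phi>"
      by (auto simp: abs_voplus_in_Omega_iff[OF assms] inv)
    then show "V.span ?S \<subseteq> Omega \<phi>" by (rule V.span_minimal[OF _ sub])
    have gen: "abs_voplus (inv \<phi> (single (- int n) x)) \<in> V.span ?S" for n x
    proof -
      have "x \<in> span Basis" by (simp add: span_Basis)
      then show ?thesis
      proof (induction rule: span_induct_alt)
        case base
        show ?case by (simp add: simps(3) V.span_zero flip: zero_voplus.abs_eq)
      next
        case (step c e x)
        have "single (- int n) (scale c e + x) =
            kmult c (tshift (- int n) (single 0 e)) + single (- int n) x"
          by (simp add: single_add)
        then have "inv \<phi> (single (- int n) (scale c e + x)) =
            kmult c (tshift (- int n) (inv \<phi> (single 0 e))) + inv \<phi> (single (- int n) x)"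
          by (simp only: simps)
        then have "abs_voplus (inv \<phi> (single (- int n) (scale c e + x))) =
            voplus_scale scale (monom c n) (abs_voplus (inv \<phi> (single 0 e))) +
            abs_voplus (inv \<phi> (single (- int n) x))"
          by (simp add: voplus_scale_abs poly_to_laurent_monom laurent_scale_single_left
              plus_voplus.abs_eq)
        then show ?case
          using step by (simp add: V.span_add V.span_scale V.span_base)
      qed
    qed
    have span: "abs_voplus (inv \<phi> y) \<in> V.span ?S" if y: "y \<in> laurent_neg" for y
    proof (induction y rule: poly_mapping_add_induct)
      case zero
      show ?case by (simp add: simps(3) V.span_zero flip: zero_voplus.abs_eq)
    next
      case (single i)
      then have "i \<le> 0" by (rule keys_laurent_neg[OF y])
      then show ?case using gen[of "nat (- i)"] by simp
    next
      case (add x y)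
      then show ?case by (simp add: simps(1) V.span_add flip: plus_voplus.abs_eq)
    qed
    show "Omega \<phi> \<subseteq> V.span ?S"
    proof
      fix x assume "x \<in> Omega \<phi>"
      then obtain v where "x = abs_voplus v" "\<phi> v \<in> laurent_neg"
        using Omega_eq_image[OF assms] by auto
      then show "x \<in> V.span ?S" using span[of "\<phi> v"] by (simp add: inv)
    qed
  qed
  then show ?thesis
    unfolding Sub_voplus_def using sub finite_Basis by blast
qed

text \<open>The closure properties are those of \<open>N\<close>. The exponent bound comes from the
  finite generating set, through the increasing submodules \<open>?B K\<close> of classes having a
  representative with exponents at most \<open>K\<close>: one of them contains all
  generators.\<close>

lemma neg_lattice_vimage_Sub_voplus:
  assumes "N \<in> Sub_voplus scale"
  shows "neg_lattice (abs_voplus -` N)"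
proof -
  interpret V: module "voplus_scale scale" by (rule module_voplus_scale)
  interpret L: module "laurent_scale scale" by (rule module_laurent_scale)
  obtain S where sub: "V.subspace N" and S: "finite S" "V.span S = N"
    using assms by (auto simp: Sub_voplus_def)
  have monom: "voplus_scale scale (monom c n) (abs_voplus v) = abs_voplus (kmult c (tshift (- int n) v))"
    for c n v
    by (simp add: voplus_scale_abs poly_to_laurent_monom laurent_scale_single_left)
  let ?B = "\<lambda>K. {x. \<exists>v. x = abs_voplus v \<and> tshift (- K) v \<in> laurent_neg}"
  have subB: "V.subspace (?B K)" for K
  proof (rule V.subspaceI)
    show "0 \<in> ?B K" using laurent_neg_zero by (auto simp: zero_voplus.abs_eq intro!: exI[of _ 0])
    show "x + y \<in> ?B K" if "x \<in> ?B K" "y \<in> ?B K" for x y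
      using that laurent_neg_add by (force simp: plus_voplus.abs_eq tshift_add)
    show "voplus_scale scale p x \<in> ?B K" if x: "x \<in> ?B K" for p x
    proof -
      obtain v where v: "x = abs_voplus v" "tshift (- K) v \<in> laurent_neg" using x by blast
      have "tshift (- K) (laurent_scale scale (poly_to_laurent p) v) =
          laurent_scale scale (poly_to_laurent p) (tshift (- K) v)"
        by (simp add: tshift_def mult.commute)
      then have "tshift (- K) (laurent_scale scale (poly_to_laurent p) v) \<in> laurent_neg"
        using laurent_scale_neg[OF v(2)] by simp
      then show ?thesis using v(1) by (auto simp: voplus_scale_abs)
    qed
  qed
  have mono: "?B K \<subseteq> ?B K'" if "K \<le> K'" for K K'
  proof
    fix x assume "x \<in> ?B K"
    then obtain v where v: "x = abs_voplus v" "tshift (- K) v \<in> laurent_neg" by blast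
    have "tshift (K - K') (tshift (- K) v) \<in> laurent_neg"
      by (rule tshift_laurent_neg[OF v(2)]) (use that in simp)
    then have "tshift (- K') v \<in> laurent_neg" by simp
    with v(1) show "x \<in> ?B K'" by blast
  qed
  have "\<exists>K\<ge>0. S \<subseteq> ?B K"
    using S(1)
  proof (induction S rule: finite_induct)
    case empty
    show ?case by auto
  next
    case (insert x S)
    then obtain K where K: "K \<ge> 0" "S \<subseteq> ?B K" by blast
    obtain v where v: "x = abs_voplus v" using abs_voplus_surj by blast
    define K' where "K' = Max (insert 0 (keys v))"
    have "lookup v i = 0" if "i > K'" for i
    proof (rule ccontr)
      assume "lookup v i \<noteq> 0"
      then have "i \<le> K'" unfolding K'_def by (intro Max_ge) (simp_all add: in_keys_iff)
      with that show False by simp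
    qed
    then have "x \<in> ?B K'" using v by (auto simp: laurent_neg_def)
    then have "x \<in> ?B (max K K')"
      by (rule subsetD[OF mono[OF max.cobounded2]])
    moreover have "S \<subseteq> ?B (max K K')"
      using K(2) mono[OF max.cobounded1] by (rule order_trans)
    ultimately have "insert x S \<subseteq> ?B (max K K')" by (rule insert_subsetI)
    moreover have "0 \<le> max K K'" using K(1) by simp
    ultimately show ?case by blast
  qed
  then obtain K where K: "K \<ge> 0" "S \<subseteq> ?B K" by blast
  then have NB: "N \<subseteq> ?B K" using V.span_minimal[OF K(2) subB] S(2) by simp
  \<comment> \<open>Any two representatives differ by a member of \<open>laurent_neg\<close>; as
    \<open>K \<ge> 0\<close>, the bound holds for all of them once it holds for one.\<close>
  have bound: "lookup v i = 0" if v: "abs_voplus v \<in> N" and i: "i > K" for v i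
  proof -
    obtain w where w: "abs_voplus v = abs_voplus w" "tshift (- K) w \<in> laurent_neg"
      using NB v by blast
    have "i - K > 0" using i by simp
    then have "lookup (tshift (- K) w) (i - K) = 0"
      using w(2) unfolding laurent_neg_def by blast
    moreover have "lookup (v - w) i = 0"
      using w(1) i K(1) by (simp add: abs_voplus_eq_iff laurent_neg_def)
    ultimately show ?thesis by (simp add: lookup_minus)
  qed
  show ?thesis
    unfolding neg_lattice_def
  proof (intro conjI subsetI allI ballI exI[of _ K] impI)
    show "v \<in> abs_voplus -` N" if "v \<in> laurent_neg" for v
      using that V.subspace_0[OF sub] by (simp add: abs_voplus_eq_0_iff[THEN iffD2])
    show "v + w \<in> abs_voplus -` N" if "v \<in> abs_voplus -` N" "w \<in> abs_voplus -` N" for v w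
      using V.subspace_add[OF sub, of "abs_voplus v" "abs_voplus w"] that
      by (simp add: plus_voplus.abs_eq)
    have scale: "voplus_scale scale p (abs_voplus v) \<in> N" if "v \<in> abs_voplus -` N" for p v
      using that by (intro V.subspace_scale sub) simp
    show "kmult c v \<in> abs_voplus -` N" if "v \<in> abs_voplus -` N" for c v
      using scale[OF that, of "monom c 0"] by (simp add: monom)
    show "tshift (- 1) v \<in> abs_voplus -` N" if "v \<in> abs_voplus -` N" for v
    proof -
      have "kmult 1 (tshift (- 1) v) = tshift (- 1) v" by (rule poly_mapping_eqI) simp
      then show ?thesis
        using scale[OF that, of "monom 1 1"] by (simp add: monom)
    qed
    show "lookup v i = 0" if "v \<in> abs_voplus -` N" "K < i" for v i
      using bound that by simp
  qed
qed

text \<open>For surjectivity, the lattice over \<open>N\<close> is the preimage of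
  \<open>laurent_neg\<close> under some \<phi>, and its image in the quotient is both
  \<open>N\<close> and the kernel of \<phi>.\<close>

lemma bij_betw_Omega: "bij_betw Omega (PPU_minus scale b) (Sub_voplus scale)"
proof (rule bij_betw_imageI)
  show "inj_on Omega (PPU_minus scale b)"
    by (intro inj_onI inj_onD[OF inj_on_vimage_neg] equalityI)
      (simp_all flip: Omega_mono_iff)
  have "N \<in> Omega ` PPU_minus scale b" if N: "N \<in> Sub_voplus scale" for N
  proof -
    obtain \<phi> where \<phi>: "\<phi> \<in> PPU_minus scale b" "\<phi> -` laurent_neg = abs_voplus -` N"
      using paraunitary_of_neg_lattice[OF neg_lattice_vimage_Sub_voplus[OF N]] by blast
    have "N = Omega \<phi>"
      using abs_voplus_surj by (auto simp: Omega_eq_image[OF \<phi>(1)] \<phi>(2))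
    with \<phi>(1) show ?thesis by blast
  qed
  then show "Omega ` PPU_minus scale b = Sub_voplus scale"
    using Omega_in_Sub_voplus by blast
qed

section \<open>Meets, joins and the poset isomorphism\<close>

lemma neg_lattice_Int:
  assumes "neg_lattice M" "neg_lattice N"
  shows "neg_lattice (M \<inter> N)"
proof -
  obtain K where "\<And>v i. v \<in> M \<Longrightarrow> i > int K \<Longrightarrow> lookup v i = 0"
    using assms(1) by (rule neg_lattice_bound) blast
  then show ?thesis
    using neg_latticeD[OF assms(1)] neg_latticeD[OF assms(2)]
    unfolding neg_lattice_def by (intro conjI exI[of _ "int K"]) auto
qed

lemma neg_lattice_sum:
  assumes M: "neg_lattice M" and N: "neg_lattice N"
  shows "neg_lattice {v + w |v w. v \<in> M \<and> w \<in> N}" (is "neg_lattice ?S")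
proof -
  obtain K where K: "\<And>v i. v \<in> M \<Longrightarrow> i > int K \<Longrightarrow> lookup v i = 0"
    using M by (rule neg_lattice_bound) blast
  obtain K' where K': "\<And>v i. v \<in> N \<Longrightarrow> i > int K' \<Longrightarrow> lookup v i = 0"
    using N by (rule neg_lattice_bound) blast
  have I: "v + w \<in> ?S" if "v \<in> M" "w \<in> N" for v w using that by blast
  show ?thesis
    unfolding neg_lattice_def
  proof (intro conjI subsetI allI ballI exI[of _ "max (int K) (int K')"] impI)
    fix u assume "u \<in> ?S"
    then obtain v w where u: "u = v + w" "v \<in> M" "w \<in> N" by blast
    show "u + u' \<in> ?S" if u'_in: "u' \<in> ?S" for u'
    proof -
      obtain v' w' where u': "u' = v' + w'" "v' \<in> M" "w' \<in> N" using u'_in by blast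
      have "u + u' = (v + v') + (w + w')" by (simp add: u(1) u'(1) ac_simps)
      then show ?thesis
        using I[OF neg_latticeD(2)[OF M u(2) u'(2)] neg_latticeD(2)[OF N u(3) u'(3)]] by simp
    qed
    show "kmult c u \<in> ?S" for c
      unfolding u(1) kmult_add by (intro I neg_latticeD(3) M N u)
    show "tshift (- 1) u \<in> ?S"
      unfolding u(1) tshift_add by (intro I neg_latticeD(4) M N u)
    show "lookup u i = 0" if "i > max (int K) (int K')" for i
      using that u by (simp add: lookup_add K K')
  next
    fix v :: "int \<Rightarrow>\<^sub>0 'b" assume "v \<in> laurent_neg"
    then have "v \<in> M" using neg_latticeD(1)[OF M] by blast
    then have "v + 0 \<in> ?S" using neg_lattice_0[OF N] by (rule I)
    then show "v \<in> ?S" by simp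
  qed
qed

text \<open>Intersections and sums of two lattices are again of the form \<open>neg_lattice\<close>,
  and each such lattice comes from a paraunitary map.\<close>

lemma modular_lattice_PPU_minus: "modular_lattice (PPU_minus_order scale b)"
  unfolding PPU_minus_order_def
proof (rule modular_latticeI[OF inj_on_vimage_neg right_divides_iff])
  fix x y assume x: "x \<in> PPU_minus scale b" and y: "y \<in> PPU_minus scale b"
  note M = neg_lattice_vimage_PPU_minus[OF x] and N = neg_lattice_vimage_PPU_minus[OF y]
  show "\<exists>z\<in>PPU_minus scale b. z -` laurent_neg = x -` laurent_neg \<inter> y -` laurent_neg"
    by (rule paraunitary_of_neg_lattice[OF neg_lattice_Int[OF M N]]) (rule bexI)
  show "\<exists>z\<in>PPU_minus scale b. z -` laurent_neg =
      {v + w |v w. v \<in> x -` laurent_neg \<and> w \<in> y -` laurent_neg}"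
    by (rule paraunitary_of_neg_lattice[OF neg_lattice_sum[OF M N]]) (rule bexI)
next
  fix x v w assume "x \<in> PPU_minus scale b"
  note M = neg_lattice_vimage_PPU_minus[OF this]
  show "0 \<in> x -` laurent_neg" by (rule neg_lattice_0[OF M])
  assume "v \<in> x -` laurent_neg" "w \<in> x -` laurent_neg"
  then show "v + w \<in> x -` laurent_neg" "v - w \<in> x -` laurent_neg"
    by (rule neg_latticeD(2)[OF M], rule neg_lattice_diff[OF M])
qed

lemma poset_isomorphism_Omega:
  "poset_isomorphism (PPU_minus_order scale b) (Sub_voplus_order scale) Omega"
  unfolding poset_isomorphism_def
proof (intro conjI ballI)
  interpret modular_lattice "PPU_minus_order scale b" by (rule modular_lattice_PPU_minus)
  show "partial_order (PPU_minus_order scale b)" by (rule partial_order_axioms)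
  show "partial_order (Sub_voplus_order scale)"
    unfolding Sub_voplus_order_def by (rule partial_orderI) auto
  show "bij_betw Omega (carrier (PPU_minus_order scale b)) (carrier (Sub_voplus_order scale))"
    using bij_betw_Omega by (simp add: PPU_minus_order_def Sub_voplus_order_def)
  show "\<phi> \<sqsubseteq>\<^bsub>PPU_minus_order scale b\<^esub> \<psi> \<longleftrightarrow> Omega \<phi> \<sqsubseteq>\<^bsub>Sub_voplus_order scale\<^esub> Omega \<psi>"
    if "\<phi> \<in> carrier (PPU_minus_order scale b)" "\<psi> \<in> carrier (PPU_minus_order scale b)" for \<phi> \<psi>
    using that
    by (simp add: PPU_minus_order_def Sub_voplus_order_def right_divides_iff Omega_mono_iff)
qed

end

theorem theorem4:
  fixes scale :: "'k::field \<Rightarrow> 'v::ab_group_add \<Rightarrow> 'v"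
    and Basis :: "'v set"
    and b :: "'v \<Rightarrow> 'v \<Rightarrow> 'k"
  assumes "finite_dimensional_vector_space scale Basis"
    and "bilinear_form scale b"
    and "symmetric_form b"
    and "anisotropic b"
  shows "poset_isomorphism (PPU_minus_order scale b) (Sub_voplus_order scale) Omega \<and>
    modular_lattice (PPU_minus_order scale b)"
proof -
  interpret anisotropic_space scale Basis b
    using assms by (simp add: anisotropic_space_def anisotropic_space_axioms_def)
  show ?thesis
    using poset_isomorphism_Omega modular_lattice_PPU_minus by blast
qed

end
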